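(* Let $\{\lambda_m\}_{m=1}^{M}$ and $\{\mu_n\}_{n=1}^{N}$ be any nonnegative nonincreasing sequences. Every sequence of vectors $F=\{f_n\}_{n=1}^{N}$ in $\mathbb{H}_M$ whose frame operator $FF^*$ has spectrum $\{\lambda_m\}_{m=1}^{M}$ and which satisfies $\|f_n\|^2=\mu_n$ for all $n$ can be constructed by the following algorithm: A. Pick a sequence of eigensteps $\{\{\lambda_{n;m}\}_{m=1}^{M}\}_{n=0}^{N}$ for $\{\lambda_m\}_{m=1}^{M}$ and $\{\mu_n\}_{n=1}^{N}$. B. Let $U_1$ be any $M\times M$ unitary matrix, with columns $U_1=\{u_{1;m}\}_{m=1}^M$, and let $f_1=\sqrt{\mu_1}\,u_{1;1}$. For each $n=1,\dots,N-1$: B.1. Let $V_n$ be an (arbitrary) $M\times M$ block-diagonal unitary matrix whose blocks correspond to the distinct values of $\{\lambda_{n;m}\}_{m=1}^M$, with the size of each block being the multiplicity of the corresponding eigenvalue. B.2. Let $\mathcal{I}_n\subseteq\{1,\dots,M\}$ consist of those indices $m$ such that $\lambda_{n;m}<\lambda_{n;m'}$ for all $m'<m$ and such that the multiplicity of $\lambda_{n;m}$ as a value in $\{\lambda_{n;m'}\}_{m'=1}^M$ exceeds its multiplicity as a value in $\{\lambda_{n+1;m'}\}_{m'=1}^M$. Let $\mathcal{J}_n\subseteq\{1,\dots,M\}$ consist of those indices $m$ such that $\lambda_{n+1;m}<\lambda_{n+1;m'}$ for all $m'<m$ and such that the multiplicity of $\lambda_{n+1;m}$ as a value in $\{\lambda_{n+1;m'}\}_{m'=1}^M$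 exceeds its multiplicity as a value in $\{\lambda_{n;m'}\}_{m'=1}^M$. The sets $\mathcal{I}_n$ and $\mathcal{J}_n$ have equal cardinality, which we denote $R_n$. Let $\pi_{\mathcal{I}_n}$ be the unique permutation on $\{1,\dots,M\}$ that is increasing on both $\mathcal{I}_n$ and its complement $\mathcal{I}_n^{\mathrm{c}}$ and such that $\pi_{\mathcal{I}_n}(m)\in\{1,\dots,R_n\}$ for all $m\in\mathcal{I}_n$; let $\Pi_{\mathcal{I}_n}$ be the associated permutation matrix, $\Pi_{\mathcal{I}_n}\delta_m=\delta_{\pi_{\mathcal{I}_n}(m)}$. Let $\pi_{\mathcal{J}_n}$ be the unique permutation on $\{1,\dots,M\}$ that is increasing on both $\mathcal{J}_n$ and its complement $\mathcal{J}_n^{\mathrm{c}}$ and such that $\pi_{\mathcal{J}_n}(m)\in\{1,\dots,R_n\}$ for all $m\in\mathcal{J}_n$; let $\Pi_{\mathcal{J}_n}$ be the associated permutation matrix, $\Pi_{\mathcal{J}_n}\delta_m=\delta_{\pi_{\mathcal{J}_n}(m)}$. B.3. Let $v_n$, $w_n$ be the $R_n\times 1$ vectors whose entries are, for all $m\in\mathcal{I}_n$ and $m'\in\mathcal{J}_n$, $$v_n(\pi_{\mathcal{I}_n}(m))=\left[-\,\frac{\prod_{m''\in\mathcal{J}_n}(\lambda_{n;m}-\lambda_{n+1;m''})}{\prod_{m''\in\mathcal{I}_n,\ m''\neq m}(\lambda_{n;m}-\lambda_{n;m''})}\right]^{\frac12},\qquad w_n(\pi_{\mathcal{J}_n}(m'))=\left[\frac{\prod_{m''\in\mathcal{I}_n}(\lambda_{n+1;m'}-\lambda_{n;m''})}{\prod_{m''\in\mathcal{J}_n,\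 m''\neq m'}(\lambda_{n+1;m'}-\lambda_{n+1;m''})}\right]^{\frac12}.$$ B.4. Let $f_{n+1}=U_nV_n\Pi_{\mathcal{I}_n}^{\mathrm{T}}\begin{bmatrix}v_n\\0\end{bmatrix}$, where the $M\times1$ vector $\begin{bmatrix}v_n\\0\end{bmatrix}$ is $v_n$ padded with $M-R_n$ zeros. B.5. Let $U_{n+1}=U_nV_n\Pi_{\mathcal{I}_n}^{\mathrm{T}}\begin{bmatrix}W_n&0\\0&\mathrm{I}\end{bmatrix}\Pi_{\mathcal{J}_n}$, where $W_n$ is the $R_n\times R_n$ matrix whose entries are, for $m\in\mathcal{I}_n$ and $m'\in\mathcal{J}_n$, $$W_n(\pi_{\mathcal{I}_n}(m),\pi_{\mathcal{J}_n}(m'))=\frac{1}{\lambda_{n+1;m'}-\lambda_{n;m}}\,v_n(\pi_{\mathcal{I}_n}(m))\,w_n(\pi_{\mathcal{J}_n}(m')).$$ Conversely, any $F$ constructed by this process has $\{\lambda_m\}_{m=1}^{M}$ as the spectrum of $FF^*$ and $\|f_n\|^2=\mu_n$ for all $n$. Moreover, for any $F$ constructed in this manner and any $n=1,\dotsc,N$, the spectrum of the frame operator $F_nF_n^*$ arising from the partial sequence $F_n=\{f_{n'}\}_{n'=1}^{n}$ is $\{\lambda_{n;m}\}_{m=1}^{M}$, and the columns of $U_n$ form a corresponding orthonormal eigenbasis for $F_nF_n^*$.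
   Context: $\mathbb{K}$ is either $\mathbb{R}$ or $\mathbb{C}$, and $\mathbb{H}_M$ is an $M$-dimensional Hilbert space over $\mathbb{K}$, viewed as $\mathbb{K}^M$; matrices are over $\mathbb{K}$ (so "unitary" means orthogonal when $\mathbb{K}=\mathbb{R}$). A finite sequence of vectors $F=\{f_n\}_{n=1}^{N}$ in $\mathbb{H}_M$ is identified with its synthesis operator $F:\mathbb{K}^N\to\mathbb{H}_M$, $Fg=\sum_{n=1}^N g(n)f_n$, i.e. the $M\times N$ matrix with columns $f_n$. Its frame operator is $FF^*=\sum_{n=1}^N f_nf_n^*$, where $f_n^*f=\langle f,f_n\rangle$. The vectors are not required to span $\mathbb{H}_M$. "Spectrum" means the list of the $M$ eigenvalues, repeated according to multiplicity and arranged in nonincreasing order. $\delta_m$ is the $m$th standard basis vector, $\mathrm{I}$ is an identity matrix of the appropriate size, and $\mathrm{T}$ denotes transpose. The diagonal blocks of $V_n$ appear in the order of the (nonincreasing) distinct values of $\{\lambda_{n;m}\}_{m=1}^M$. Empty products equal $1$, and blocks of size $0$ are simply absent. Interlacing: for nonincreasing sequences, $\{\beta_m\}_{m=1}^{M}\sqsubseteq\{\gamma_m\}_{m=1}^{M}$ means $\beta_M\leq\gamma_M\leq\beta_{M-1}\leq\gamma_{M-1}\leq\dots\leq\beta_2\leq\gamma_2\leq\beta_1\leq\gamma_1$. Eigensteps: given nonnegative nonincreasing sequences $\{\lambda_m\}_{m=1}^{M}$ and $\{\mu_n\}_{n=1}^{N}$, a sequence of eigensteps is a doubly-indexed sequence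 $\{\{\lambda_{n;m}\}_{m=1}^{M}\}_{n=0}^{N}$, each $\{\lambda_{n;m}\}_{m=1}^M$ being nonnegative and nonincreasing in $m$, such that: (i) $\lambda_{0;m}=0$ for all $m=1,\dotsc,M$; (ii) $\lambda_{N;m}=\lambda_m$ for all $m=1,\dotsc,M$; (iii) $\{\lambda_{n-1;m}\}_{m=1}^{M}\sqsubseteq\{\lambda_{n;m}\}_{m=1}^{M}$ for all $n=1,\dotsc,N$; (iv) $\sum_{m=1}^{M}\lambda_{n;m}=\sum_{n'=1}^{n}\mu_{n'}$ for all $n=1,\dotsc,N$. The theorem does not claim that eigensteps, or such an $F$, exist for given $\{\lambda_m\}$ and $\{\mu_n\}$. "Can be constructed by the algorithm" means that $F$ is the output for some admissible choices of the eigensteps, of $U_1$, and of $V_1,\dots,V_{N-1}$. *)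

theory Defs
  imports
    "Jordan_Normal_Form.Schur_Decomposition"
    "HOL-Combinatorics.Permutations"
begin

text \<open>
  The field of scalars is \<open>real\<close> or \<open>complex\<close>; the definitions below are generic over a class
  containing both and are only ever used at these two types.

  Indexing. Rows, columns and everything indexed by \<open>m\<close> (the values \<open>\<lambda>\<^sub>m\<close> and \<open>\<lambda>\<^sub>n\<^sub>;\<^sub>m\<close>, the sets of
  indices, the permutations) use \<open>0, \<dots>, M - 1\<close> in place of \<open>1, \<dots>, M\<close>, as the matrix
  library does. The index \<open>n\<close> is unshifted: \<open>f n\<close>, \<open>mu n\<close>, \<open>U n\<close> for \<open>n \<in> {1..N}\<close>, \<open>V n\<close> for
  \<open>n \<in> {1..<N}\<close>, and \<open>E n m\<close> for \<open>n \<in> {0..N}\<close>. Values outside these ranges are irrelevant.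
\<close>

section \<open>Finite sequences of vectors, spectra, eigenbases\<close>

definition frame_operator :: "nat \<Rightarrow> nat \<Rightarrow> (nat \<Rightarrow> 'a::{conjugatable_field,real_field} vec) \<Rightarrow> 'a mat"
  where "frame_operator M n f =
    (let F = mat_of_cols M (map f [1..<Suc n]) in F * mat_adjoint F)"

text \<open>Eigenvalues are counted as roots of the characteristic polynomial.\<close>

definition has_spectrum :: "nat \<Rightarrow> 'a::{conjugatable_field,real_field} mat \<Rightarrow> (nat \<Rightarrow> real) \<Rightarrow> bool"
  where "has_spectrum M A lam \<longleftrightarrow>
    A \<in> carrier_mat M M \<and> antimono_on {..<M} lam \<and>
    char_poly A = (\<Prod>m<M. [:- of_real (lam m), 1:])"

definition unitary_mat :: "nat \<Rightarrow> 'a::{conjugatable_field,real_field} mat \<Rightarrow> bool"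
  where "unitary_mat M U \<longleftrightarrow>
    U \<in> carrier_mat M M \<and> U * mat_adjoint U = 1\<^sub>m M \<and> mat_adjoint U * U = 1\<^sub>m M"

definition orthonormal_eigenbasis ::
    "nat \<Rightarrow> 'a::{conjugatable_field,real_field} mat \<Rightarrow> (nat \<Rightarrow> real) \<Rightarrow> 'a mat \<Rightarrow> bool"
  where "orthonormal_eigenbasis M A lam U \<longleftrightarrow>
    U \<in> carrier_mat M M \<and>
    (\<forall>i<M. \<forall>j<M. col U i \<bullet>c col U j = (if i = j then 1 else 0)) \<and>
    (\<forall>m<M. eigenvector A (col U m) (of_real (lam m)))"

section \<open>Eigensteps\<close>

definition interlaces :: "nat \<Rightarrow> (nat \<Rightarrow> real) \<Rightarrow> (nat \<Rightarrow> real) \<Rightarrow> bool"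
  where "interlaces M b c \<longleftrightarrow>
    (\<forall>m<M. b m \<le> c m) \<and> (\<forall>m. Suc m < M \<longrightarrow> c (Suc m) \<le> b m)"

definition eigensteps ::
    "nat \<Rightarrow> nat \<Rightarrow> (nat \<Rightarrow> real) \<Rightarrow> (nat \<Rightarrow> real) \<Rightarrow> (nat \<Rightarrow> nat \<Rightarrow> real) \<Rightarrow> bool"
  where "eigensteps M N lam mu E \<longleftrightarrow>
    (\<forall>n\<le>N. (\<forall>m<M. 0 \<le> E n m) \<and> antimono_on {..<M} (E n)) \<and>
    (\<forall>m<M. E 0 m = 0) \<and>
    (\<forall>m<M. E N m = lam m) \<and>
    (\<forall>n\<in>{1..N}. interlaces M (E (n - 1)) (E n)) \<and>
    (\<forall>n\<in>{1..N}. (\<Sum>m<M. E n m) = (\<Sum>k=1..n. mu k))"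

section \<open>The ingredients of one step\<close>

definition multiplicity_in :: "nat \<Rightarrow> (nat \<Rightarrow> real) \<Rightarrow> real \<Rightarrow> nat"
  where "multiplicity_in M a x = card {m. m < M \<and> a m = x}"

text \<open>The blocks are ordered by the distinct values of \<open>a\<close>, largest value first.\<close>

definition block_unitary ::
    "nat \<Rightarrow> (nat \<Rightarrow> real) \<Rightarrow> 'a::{conjugatable_field,real_field} mat \<Rightarrow> bool"
  where "block_unitary M a V \<longleftrightarrow>
    unitary_mat M V \<and>
    (\<exists>Bs. list_all2 (\<lambda>B x. B \<in> carrier_mat (multiplicity_in M a x) (multiplicity_in M a x))
            Bs (rev (sorted_list_of_set (a ` {..<M}))) \<and>
          V = diag_block_mat Bs)"

text \<open>
  With \<open>a = \<lambda>\<^sub>n\<close> and \<open>b = \<lambda>\<^sub>n\<^sub>+\<^sub>1\<close>, the sets \<open>\<I>\<^sub>n\<close> and \<open>\<J>\<^sub>n\<close> are \<open>excess_indices M a b\<close> and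
  \<open>excess_indices M b a\<close>.
\<close>

definition excess_indices :: "nat \<Rightarrow> (nat \<Rightarrow> real) \<Rightarrow> (nat \<Rightarrow> real) \<Rightarrow> nat set"
  where "excess_indices M a b =
    {m. m < M \<and> (\<forall>m'<m. a m < a m') \<and> multiplicity_in M a (a m) > multiplicity_in M b (a m)}"

definition is_sorting_perm :: "nat \<Rightarrow> nat set \<Rightarrow> (nat \<Rightarrow> nat) \<Rightarrow> bool"
  where "is_sorting_perm M S p \<longleftrightarrow>
    p permutes {..<M} \<and> strict_mono_on S p \<and> strict_mono_on ({..<M} - S) p \<and>
    (\<forall>m\<in>S. p m < card S)"

definition sorting_perm :: "nat \<Rightarrow> nat set \<Rightarrow> nat \<Rightarrow> nat"
  where "sorting_perm M S = (THE p. is_sorting_perm M S p)"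

lemma strict_mono_on_interval_value:
  fixes p :: "nat \<Rightarrow> nat"
  assumes mono: "strict_mono_on S p" and img: "p ` S = {a..<b}" and m: "m \<in> S"
  shows "p m = a + card {k \<in> S. k < m}"
proof -
  have less: "p x < p y \<longleftrightarrow> x < y" if "x \<in> S" "y \<in> S" for x y
    using strict_mono_onD[OF mono that] strict_mono_onD[OF mono that(2) that(1)]
    by (cases x y rule: linorder_cases) auto
  have "p m \<in> {a..<b}" using imageI[OF m, of p] by (simp only: img)
  then have bounds: "a \<le> p m" "p m < b" by simp_all
  have "p ` {k \<in> S. k < m} = {a..<p m}"
  proof (rule Set.set_eqI)
    fix y
    show "y \<in> p ` {k \<in> S. k < m} \<longleftrightarrow> y \<in> {a..<p m}"
    proof
      assume "y \<in> p ` {k \<in> S. k < m}"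
      then obtain k where k: "k \<in> S" "k < m" "y = p k" by auto
      then have "p k \<in> {a..<b}" using img by blast
      then show "y \<in> {a..<p m}" using less k m by auto
    next
      assume y: "y \<in> {a..<p m}"
      then have "y \<in> p ` S" using img bounds by auto
      then obtain k where k: "k \<in> S" "y = p k" by auto
      then show "y \<in> p ` {k \<in> S. k < m}" using less m y by auto
    qed
  qed
  moreover have "inj_on p {k \<in> S. k < m}"
    using strict_mono_on_imp_inj_on[OF mono] by (rule inj_on_subset) auto
  ultimately have "card {k \<in> S. k < m} = p m - a"
    using card_image[of p "{k \<in> S. k < m}"] by simp
  with bounds show ?thesis by simp
qed

lemma ex1_is_sorting_perm:
  assumes S: "S \<subseteq> {..<M}"
  shows "\<exists>!p. is_sorting_perm M S p"
proof (rule ex_ex1I)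
  let ?C = "{..<M} - S"
  have finS: "finite S" using S finite_subset by blast
  have cardC: "card S + card ?C = M"
    using S card_Diff_subset[OF finS S] card_mono[OF _ S] by simp
  define q where "q m = (if m \<in> S then card {k \<in> S. k < m}
    else if m < M then card S + card {k \<in> ?C. k < m} else m)" for m
  have step: "card {k \<in> T. k < x} < card {k \<in> T. k < y}"
    if "finite T" "x \<in> T" "x < y" for T :: "nat set" and x y
    using that by (intro psubset_card_mono) auto
  have bound: "card {k \<in> T. k < x} < card T" if "finite T" "x \<in> T" for T :: "nat set" and x
    using that by (intro psubset_card_mono) auto
  have mS: "strict_mono_on S q"
    using step[OF finS] by (auto simp: q_def strict_mono_on_def)
  have mC: "strict_mono_on ?C q"
    using step[of ?C] by (auto simp: q_def strict_mono_on_def)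
  have bS: "q m < card S" if "m \<in> S" for m
    using that bound[OF finS] by (simp add: q_def)
  have bC: "card S \<le> q m" "q m < M" if "m \<in> ?C" for m
    using that bound[of ?C m] cardC by (auto simp: q_def)
  have "inj_on q {..<M}"
  proof (rule inj_onI)
    fix x y assume xy: "x \<in> {..<M}" "y \<in> {..<M}" "q x = q y"
    show "x = y"
      using xy bS[of x] bS[of y] bC[of x] bC[of y]
        strict_mono_on_imp_inj_on[OF mS] strict_mono_on_imp_inj_on[OF mC]
      by (cases "x \<in> S"; cases "y \<in> S") (auto dest: inj_onD)
  qed
  moreover have "q ` {..<M} \<subseteq> {..<M}"
  proof
    fix y assume "y \<in> q ` {..<M}"
    then obtain x where "x < M" "y = q x" by auto
    then show "y \<in> {..<M}" using bS[of x] bC[of x] cardC by (cases "x \<in> S") auto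
  qed
  ultimately have "bij_betw q {..<M} {..<M}"
    by (simp add: bij_betw_def endo_inj_surj)
  moreover have "q x = x" if "x \<notin> {..<M}" for x
    using that S by (auto simp: q_def)
  ultimately have "q permutes {..<M}"
    by (rule bij_imp_permutes)
  then show "\<exists>p. is_sorting_perm M S p"
    unfolding is_sorting_perm_def using mS mC bS by blast
  have val: "p = q" if "is_sorting_perm M S p" for p
  proof -
    have p: "p permutes {..<M}" "strict_mono_on S p" "strict_mono_on ?C p"
      "\<And>m. m \<in> S \<Longrightarrow> p m < card S"
      using that unfolding is_sorting_perm_def by auto
    have inj: "inj_on p A" for A
      using permutes_inj[OF p(1)] by (rule inj_on_subset) simp
    have imS: "p ` S = {0..<card S}"
      using p(4) card_image[OF inj, of S] by (intro card_subset_eq) auto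
    have "p ` ?C = p ` {..<M} - p ` S"
      using permutes_inj[OF p(1)] by (rule image_set_diff)
    also have "\<dots> = {card S..<M}"
      using imS permutes_image[OF p(1)] by auto
    finally have imC: "p ` ?C = {card S..<M}" .
    show "p = q"
    proof
      fix m
      show "p m = q m"
        using strict_mono_on_interval_value[OF p(2) imS, of m]
          strict_mono_on_interval_value[OF p(3) imC, of m] permutes_not_in[OF p(1), of m] S
        by (auto simp: q_def)
    qed
  qed
  show "\<And>p p'. is_sorting_perm M S p \<Longrightarrow> is_sorting_perm M S p' \<Longrightarrow> p = p'"
    by (rule trans[OF val val[symmetric]])
qed

text \<open>Column \<open>m\<close> of the matrix of \<open>p\<close> is the standard basis vector with index \<open>p m\<close>.\<close>

definition perm_matrix :: "nat \<Rightarrow> (nat \<Rightarrow> nat) \<Rightarrow> 'a::{zero,one} mat"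
  where "perm_matrix M p = mat M M (\<lambda>(i, j). if i = p j then 1 else 0)"

definition v_entry :: "nat set \<Rightarrow> nat set \<Rightarrow> (nat \<Rightarrow> real) \<Rightarrow> (nat \<Rightarrow> real) \<Rightarrow> nat \<Rightarrow> real"
  where "v_entry I J a b m =
    sqrt (- ((\<Prod>k\<in>J. a m - b k) / (\<Prod>k\<in>I - {m}. a m - a k)))"

definition w_entry :: "nat set \<Rightarrow> nat set \<Rightarrow> (nat \<Rightarrow> real) \<Rightarrow> (nat \<Rightarrow> real) \<Rightarrow> nat \<Rightarrow> real"
  where "w_entry I J a b m =
    sqrt ((\<Prod>k\<in>I. b m - a k) / (\<Prod>k\<in>J - {m}. b m - b k))"

text \<open>
  The entry with index \<open>i\<close> belongs to the unique \<open>m \<in> I\<close> with \<open>sorting_perm M I m = i\<close>,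
  and similarly for \<open>J\<close>, a set of the same size when \<open>a\<close> and \<open>b\<close> are consecutive eigensteps.
\<close>

definition v_vec :: "nat \<Rightarrow> nat set \<Rightarrow> nat set \<Rightarrow> (nat \<Rightarrow> real) \<Rightarrow> (nat \<Rightarrow> real) \<Rightarrow> real vec"
  where "v_vec M I J a b =
    vec (card I) (\<lambda>i. v_entry I J a b (inv_into I (sorting_perm M I) i))"

definition w_vec :: "nat \<Rightarrow> nat set \<Rightarrow> nat set \<Rightarrow> (nat \<Rightarrow> real) \<Rightarrow> (nat \<Rightarrow> real) \<Rightarrow> real vec"
  where "w_vec M I J a b =
    vec (card I) (\<lambda>j. w_entry I J a b (inv_into J (sorting_perm M J) j))"

definition W_mat :: "nat \<Rightarrow> nat set \<Rightarrow> nat set \<Rightarrow> (nat \<Rightarrow> real) \<Rightarrow> (nat \<Rightarrow> real) \<Rightarrow> real mat"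
  where "W_mat M I J a b =
    mat (card I) (card I) (\<lambda>(i, j).
      1 / (b (inv_into J (sorting_perm M J) j) - a (inv_into I (sorting_perm M I) i))
      * v_vec M I J a b $ i * w_vec M I J a b $ j)"

section \<open>The algorithm\<close>

definition next_vector :: "nat \<Rightarrow> (nat \<Rightarrow> real) \<Rightarrow> (nat \<Rightarrow> real) \<Rightarrow>
    'a::{conjugatable_field,real_field} mat \<Rightarrow> 'a mat \<Rightarrow> 'a vec"
  where "next_vector M a b U V =
    (let I = excess_indices M a b; J = excess_indices M b a; R = card I in
      (U * V * transpose_mat (perm_matrix M (sorting_perm M I)))
        *\<^sub>v (map_vec of_real (v_vec M I J a b) @\<^sub>v 0\<^sub>v (M - R)))"

definition next_basis :: "nat \<Rightarrow> (nat \<Rightarrow> real) \<Rightarrow> (nat \<Rightarrow> real) \<Rightarrow>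
    'a::{conjugatable_field,real_field} mat \<Rightarrow> 'a mat \<Rightarrow> 'a mat"
  where "next_basis M a b U V =
    (let I = excess_indices M a b; J = excess_indices M b a; R = card I in
      U * V * transpose_mat (perm_matrix M (sorting_perm M I))
        * four_block_mat (map_mat of_real (W_mat M I J a b)) (0\<^sub>m R (M - R))
                         (0\<^sub>m (M - R) R) (1\<^sub>m (M - R))
        * perm_matrix M (sorting_perm M J))"

text \<open>
  The vectors \<open>f\<close> are the output for the choices \<open>E\<close> (eigensteps), \<open>U 1\<close> and \<open>V\<close>; the matrices
  \<open>U n\<close> with \<open>n > 1\<close> are determined by these choices.
\<close>

definition algorithm_run :: "nat \<Rightarrow> nat \<Rightarrow> (nat \<Rightarrow> real) \<Rightarrow> (nat \<Rightarrow> real) \<Rightarrow> (nat \<Rightarrow> nat \<Rightarrow> real) \<Rightarrow>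
    (nat \<Rightarrow> 'a::{conjugatable_field,real_field} mat) \<Rightarrow> (nat \<Rightarrow> 'a mat) \<Rightarrow> (nat \<Rightarrow> 'a vec) \<Rightarrow> bool"
  where "algorithm_run M N lam mu E U V f \<longleftrightarrow>
    eigensteps M N lam mu E \<and>
    unitary_mat M (U 1) \<and>
    f 1 = of_real (sqrt (mu 1)) \<cdot>\<^sub>v col (U 1) 0 \<and>
    (\<forall>n\<in>{1..<N}.
      block_unitary M (E n) (V n) \<and>
      f (Suc n) = next_vector M (E n) (E (Suc n)) (U n) (V n) \<and>
      U (Suc n) = next_basis M (E n) (E (Suc n)) (U n) (V n))"

definition has_spectrum_and_lengths :: "nat \<Rightarrow> nat \<Rightarrow> (nat \<Rightarrow> real) \<Rightarrow> (nat \<Rightarrow> real) \<Rightarrow>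
    (nat \<Rightarrow> 'a::{conjugatable_field,real_field} vec) \<Rightarrow> bool"
  where "has_spectrum_and_lengths M N lam mu f \<longleftrightarrow>
    has_spectrum M (frame_operator M N f) lam \<and>
    (\<forall>n\<in>{1..N}. f n \<bullet>c f n = of_real (mu n))"

end

theory Submission
  imports Defs
begin

text \<open>
  Appending a vector \<open>f\<close> to a sequence with frame operator \<open>A\<close> changes the frame operator to
  \<open>A + f f\<^sup>*\<close>. If \<open>A U = U D\<^sub>a\<close> with \<open>U\<close> unitary and \<open>D\<^sub>a\<close> the diagonal matrix of the eigenvalues
  \<open>a\<close>, and \<open>V\<close> is unitary and commutes with \<open>D\<^sub>a\<close> (which is what being block-diagonal means), then
  with \<open>Q = U V\<close> and \<open>f = Q g\<close> one has \<open>A + f f\<^sup>* = Q (D\<^sub>a + g g\<^sup>*) Q\<^sup>*\<close>. The whole theorem is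
  therefore about rank-one updates of a real diagonal matrix, and the equation
  \<open>A U = U D\<^sub>a\<close> (predicate \<open>diagonalizes\<close>) is the invariant carried from one step to the next.

  Output of the algorithm. Let \<open>a\<close> and \<open>b\<close> be consecutive eigensteps. Interlacing says that above
  any threshold \<open>b\<close> has as many entries as \<open>a\<close> or one more. Hence multiplicities in \<open>a\<close> and \<open>b\<close>
  differ by at most one, and after cancelling the common part of the two multisets of values,
  the values of \<open>a\<close> at \<open>I\<close> and of \<open>b\<close> at \<open>J\<close> remain; these are simple and strictly
  interlacing (lemma \<open>interlacing_nodes_excess_indices\<close>). Strict interlacing makes the radicands
  of \<open>v\<close> and \<open>w\<close> positive, and partial fractions show that \<open>W\<close> is orthogonal and that its columns
  are eigenvectors of \<open>D + v v\<^sup>T\<close> for the values of \<open>b\<close> at \<open>J\<close> (\<open>cauchy_orthonormal\<close>,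
  \<open>cauchy_column_dot_v\<close>). Outside \<open>I\<close> and \<open>J\<close> the same values remain in the same order, so the two
  sorting permutations match equal values. This gives the step \<open>next_step\<close>; spectra and eigenbases
  are read off from the invariant, and squared lengths are differences of traces.

  Every sequence is an output. Suppose \<open>A U = U D\<^sub>a\<close> and let \<open>f\<close> be the next vector. A block-diagonal
  unitary \<open>V\<close>, with one Householder reflection in each block, is chosen so that \<open>V\<^sup>* U\<^sup>* f\<close> has
  nonnegative entries that vanish except at the first index of each block
  (\<open>exists_block_rotation\<close>). Let \<open>K\<close> be the set of indices of its nonzero entries \<open>\<rho>\<close>. The polynomial
  \<open>\<Prod>\<^sub>k (x - a\<^sub>k) - \<Sum>\<^sub>k \<rho>\<^sub>k\<^sup>2 \<Prod>\<^sub>l (x - a\<^sub>l)\<close>, with \<open>k\<close> in \<open>K\<close> and \<open>l\<close> in \<open>K - {k}\<close>, alternates in sign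
  at the \<open>a\<^sub>k\<close>, so the intermediate value theorem gives roots \<open>r\<^sub>k\<close> that strictly interlace them
  (\<open>secular_roots\<close>). Replacing the values of \<open>a\<close> at \<open>K\<close> by these roots and sorting gives a sequence
  \<open>b\<close> with \<open>I = K\<close>, for which the formula for \<open>v\<close> returns exactly \<open>\<rho>\<close>. So \<open>f\<close> is the vector that the
  algorithm produces, and the first half of the argument supplies the next eigenbasis: the spectral
  theorem is a consequence here, not an ingredient. The last eigensteps are \<open>lam\<close> because
  a sorted spectrum is determined by the characteristic polynomial.
\<close>

section \<open>Interlacing of sorted sequences\<close>

definition values_mset :: "nat \<Rightarrow> (nat \<Rightarrow> real) \<Rightarrow> real multiset"
  where "values_mset M a = image_mset a (mset_set {..<M})"

lemma count_values_mset: "count (values_mset M a) x = multiplicity_in M a x"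
  by (simp add: values_mset_def multiplicity_in_def count_image_mset_eq_card_vimage)

lemma size_values_mset [simp]: "size (values_mset M a) = M"
  by (simp add: values_mset_def)

lemma size_filter_image_mset_set:
  assumes "finite S"
  shows "size (filter_mset P (image_mset f (mset_set S))) = card {x \<in> S. P (f x)}"
  using assms by (simp add: filter_mset_image_mset)

text \<open>
  Both functions list the same values in the same order: if \<open>g m < f m\<close>, more indices would have an
  \<open>f\<close>-value above \<open>g m\<close> than a \<open>g\<close>-value.
\<close>

lemma antimono_on_eq_if_image_mset_eq:
  fixes f g :: "nat \<Rightarrow> real"
  assumes fin: "finite S" and "antimono_on S f" and "antimono_on S g"
    and "image_mset f (mset_set S) = image_mset g (mset_set S)" and m: "m \<in> S"
  shows "f m = g m"
proof -
  have le: "f m \<le> g m" if f: "antimono_on S f" and g: "antimono_on S g"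
    and eq: "image_mset f (mset_set S) = image_mset g (mset_set S)" for f g :: "nat \<Rightarrow> real"
  proof (rule ccontr)
    assume "\<not> f m \<le> g m"
    then have gt: "g m < f m" by simp
    have "{k \<in> S. g m < g k} \<subset> {k \<in> S. g m < f k}"
    proof
      show "{k \<in> S. g m < g k} \<subseteq> {k \<in> S. g m < f k}"
      proof
        fix k assume "k \<in> {k \<in> S. g m < g k}"
        then have k: "k \<in> S" "g m < g k" by auto
        then have "k \<le> m" using monotone_onD[OF g m k(1)] by (cases "m \<le> k") auto
        then have "f m \<le> f k" using monotone_onD[OF f k(1) m] by auto
        then show "k \<in> {k \<in> S. g m < f k}" using k gt by auto
      qed
      show "{k \<in> S. g m < g k} \<noteq> {k \<in> S. g m < f k}" using gt m by auto
    qed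
    then have "card {k \<in> S. g m < g k} < card {k \<in> S. g m < f k}"
      using fin by (intro psubset_card_mono) auto
    moreover have "card {k \<in> S. g m < g k} = card {k \<in> S. g m < f k}"
      using size_filter_image_mset_set[OF fin, of "\<lambda>y. g m < y" f]
        size_filter_image_mset_set[OF fin, of "\<lambda>y. g m < y" g] eq by simp
    ultimately show False by simp
  qed
  show ?thesis using le[of f g] le[of g f] assms by auto
qed

text \<open>
  Entries above a threshold are counted both with \<open><\<close> and with \<open>\<le>\<close>; comparing the two counts
  isolates a single multiplicity.
\<close>

definition up_closed :: "(real \<Rightarrow> bool) \<Rightarrow> bool"
  where "up_closed P \<longleftrightarrow> (\<forall>x y. P x \<longrightarrow> x \<le> y \<longrightarrow> P y)"

lemma up_closed_greater [simp]: "up_closed (\<lambda>y. x < y)" and up_closed_ge [simp]: "up_closed (\<lambda>y. x \<le> y)"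
  by (auto simp: up_closed_def)

text \<open>
  Index \<open>m\<close> of \<open>a\<close> injects into index \<open>m\<close> of \<open>b\<close>, and index \<open>m + 1\<close> of \<open>b\<close> into index \<open>m\<close> of \<open>a\<close>; only
  index \<open>0\<close> of \<open>b\<close> has no partner.
\<close>

lemma interlaces_imp_counts:
  assumes "interlaces M a b" and "up_closed P"
  shows "size (filter_mset P (values_mset M a)) \<le> size (filter_mset P (values_mset M b))"
    and "size (filter_mset P (values_mset M b)) \<le> Suc (size (filter_mset P (values_mset M a)))"
proof -
  have "{m \<in> {..<M}. P (a m)} \<subseteq> {m \<in> {..<M}. P (b m)}"
    using assms by (auto simp: interlaces_def up_closed_def)
  then show "size (filter_mset P (values_mset M a)) \<le> size (filter_mset P (values_mset M b))"
    by (simp add: values_mset_def size_filter_image_mset_set card_mono)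
  have "{m \<in> {..<M}. P (b m)} \<subseteq> insert 0 (Suc ` {m \<in> {..<M}. P (a m)})"
  proof
    fix m assume m: "m \<in> {m \<in> {..<M}. P (b m)}"
    show "m \<in> insert 0 (Suc ` {m \<in> {..<M}. P (a m)})"
    proof (cases m)
      case (Suc k)
      then have "b (Suc k) \<le> a k" using m assms(1) by (auto simp: interlaces_def)
      then have "P (a k)" using m Suc assms(2) by (auto simp: up_closed_def)
      then show ?thesis using m Suc by auto
    qed simp
  qed
  then have "card {m \<in> {..<M}. P (b m)} \<le> card (insert 0 (Suc ` {m \<in> {..<M}. P (a m)}))"
    by (intro card_mono) auto
  also have "\<dots> \<le> Suc (card {m \<in> {..<M}. P (a m)})"
    by (metis (no_types, lifting) card_image card_insert_le_m1 diff_Suc_1 inj_Suc le_refl zero_less_Suc)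
  finally show "size (filter_mset P (values_mset M b)) \<le> Suc (size (filter_mset P (values_mset M a)))"
    by (simp add: values_mset_def size_filter_image_mset_set)
qed

lemma counts_imp_interlaces:
  assumes a: "antimono_on {..<M} a" and b: "antimono_on {..<M} b"
    and lo: "\<And>x. size {#y \<in># values_mset M a. x < y#} \<le> size {#y \<in># values_mset M b. x < y#}"
    and hi: "\<And>x. size {#y \<in># values_mset M b. x < y#} \<le> Suc (size {#y \<in># values_mset M a. x < y#})"
  shows "interlaces M a b"
proof -
  have card_le: "card {m \<in> {..<M}. c k < c m} \<le> k" if "antimono_on {..<M} c" "k < M" for c :: "nat \<Rightarrow> real" and k
  proof -
    have "{m \<in> {..<M}. c k < c m} \<subseteq> {..<k}"
    proof
      fix m assume "m \<in> {m \<in> {..<M}. c k < c m}"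
      then show "m \<in> {..<k}" using monotone_onD[OF that(1), of k m] that(2) by (cases "k \<le> m") auto
    qed
    then show ?thesis using card_mono[of "{..<k}"] by fastforce
  qed
  have card_ge: "Suc k \<le> card {m \<in> {..<M}. x < c m}" if "antimono_on {..<M} c" "k < M" "x < c k"
    for c :: "nat \<Rightarrow> real" and k x
  proof -
    have "{..k} \<subseteq> {m \<in> {..<M}. x < c m}"
    proof
      fix m assume "m \<in> {..k}"
      then show "m \<in> {m \<in> {..<M}. x < c m}" using monotone_onD[OF that(1), of m k] that(2,3) by auto
    qed
    then show ?thesis using card_mono[of "{m \<in> {..<M}. x < c m}" "{..k}"] by auto
  qed
  note counts = lo[unfolded values_mset_def size_filter_image_mset_set[OF finite_lessThan]]
    hi[unfolded values_mset_def size_filter_image_mset_set[OF finite_lessThan]]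
  have "a m \<le> b m" if "m < M" for m
  proof (rule ccontr)
    assume "\<not> a m \<le> b m"
    then have "b m < a m" by simp
    from card_ge[OF a that this] card_le[OF b that] counts(1)[of "b m"] show False by simp
  qed
  moreover have "b (Suc m) \<le> a m" if "Suc m < M" for m
  proof (rule ccontr)
    assume "\<not> b (Suc m) \<le> a m"
    then have "a m < b (Suc m)" by simp
    from card_ge[OF b that this] card_le[OF a, of m] that counts(2)[of "a m"] show False by simp
  qed
  ultimately show ?thesis by (simp add: interlaces_def)
qed

lemma size_filter_ge:
  fixes A :: "real multiset"
  shows "size {#y \<in># A. x \<le> y#} = count A x + size {#y \<in># A. x < y#}"
  by (induction A) auto

lemma interlaces_imp_multiplicity:
  assumes "interlaces M a b"
  shows "multiplicity_in M a x \<le> Suc (multiplicity_in M b x)"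
    and "multiplicity_in M b x \<le> Suc (multiplicity_in M a x)"
  using interlaces_imp_counts[OF assms up_closed_greater[of x]]
    interlaces_imp_counts[OF assms up_closed_ge[of x]]
  by (simp_all add: size_filter_ge count_values_mset)

section \<open>Excess indices\<close>

lemma finite_excess_indices [simp]: "finite (excess_indices M a b)"
  by (rule finite_subset[of _ "{..<M}"]) (auto simp: excess_indices_def)

lemma excess_indices_subset: "excess_indices M a b \<subseteq> {..<M}"
  by (auto simp: excess_indices_def)

lemma inj_on_excess_indices: "inj_on a (excess_indices M a b)"
proof (rule inj_onI)
  fix k l assume "k \<in> excess_indices M a b" "l \<in> excess_indices M a b" "a k = a l"
  then show "k = l" by (cases k l rule: linorder_cases) (auto simp: excess_indices_def)
qed

lemma first_index_exists:
  fixes a :: "nat \<Rightarrow> real"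
  assumes a: "antimono_on {..<M} a" and "m < M"
  shows "\<exists>k<M. a k = a m \<and> (\<forall>l<k. a k < a l)"
proof -
  define k where "k = (LEAST k. k < M \<and> a k = a m)"
  have k: "k < M" "a k = a m" using LeastI[of "\<lambda>k. k < M \<and> a k = a m" m] assms(2) by (auto simp: k_def)
  have "a k < a l" if "l < k" for l
  proof -
    have "a l \<noteq> a m" using not_less_Least[of l "\<lambda>k. k < M \<and> a k = a m"] that k by (auto simp: k_def)
    then show ?thesis using monotone_onD[OF a, of l k] that k by auto
  qed
  with k show ?thesis by blast
qed

text \<open>
  An excess index stands for a value that occurs once more in \<open>a\<close> than in \<open>b\<close>. As multiplicities
  exceed each other by at most one, the excess indices select the multiset difference of the values.
\<close>

lemma image_mset_excess_indices:
  assumes a: "antimono_on {..<M} a"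
    and le: "\<And>x. multiplicity_in M a x \<le> Suc (multiplicity_in M b x)"
  shows "image_mset a (mset_set (excess_indices M a b)) = values_mset M a - values_mset M b"
proof (rule multiset_eqI)
  fix x
  let ?S = "{m \<in> excess_indices M a b. a m = x}"
  have "card ?S = multiplicity_in M a x - multiplicity_in M b x"
  proof (cases "multiplicity_in M b x < multiplicity_in M a x")
    case True
    then have "{m. m < M \<and> a m = x} \<noteq> {}"
      unfolding multiplicity_in_def by (metis card.empty not_less_zero)
    then obtain m where m: "m < M" "a m = x" by auto
    from first_index_exists[OF a m(1)] obtain k where "k < M" "a k = x" "\<forall>l<k. a k < a l"
      using m by auto
    with True have k: "k \<in> ?S" by (auto simp: excess_indices_def)
    have "?S = {k}" using k inj_on_excess_indices[of a M b] by (auto dest: inj_onD)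
    then show ?thesis using True le[of x] by simp
  next
    case False
    then have "?S = {}" by (auto simp: excess_indices_def)
    then show ?thesis using False by (metis (no_types, lifting) card.empty diff_is_0_eq linorder_not_less)
  qed
  then show "count (image_mset a (mset_set (excess_indices M a b))) x =
      count (values_mset M a - values_mset M b) x"
    by (simp add: count_image_mset_eq_card_vimage count_values_mset)
qed

text \<open>
  The right-hand side is symmetric in \<open>a\<close> and \<open>b\<close>: what remains of either sequence is the same
  multiset.
\<close>

lemma image_mset_excess_indices_compl:
  assumes a: "antimono_on {..<M} a"
    and le: "\<And>x. multiplicity_in M a x \<le> Suc (multiplicity_in M b x)"
  shows "image_mset a (mset_set ({..<M} - excess_indices M a b)) =
    values_mset M a \<inter># values_mset M b"
proof -
  let ?I = "excess_indices M a b"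
  have "{..<M} = ?I \<union> ({..<M} - ?I)" using excess_indices_subset[of M a b] by auto
  then have "mset_set {..<M} = mset_set ?I + mset_set ({..<M} - ?I)"
    by (metis Diff_disjoint finite_Diff finite_excess_indices finite_lessThan mset_set_Union)
  then have "values_mset M a =
      image_mset a (mset_set ?I) + image_mset a (mset_set ({..<M} - ?I))"
    by (simp add: values_mset_def)
  then have "image_mset a (mset_set ({..<M} - ?I)) =
      values_mset M a - (values_mset M a - values_mset M b)"
    using image_mset_excess_indices[OF assms] by (metis add_diff_cancel_left')
  also have "\<dots> = values_mset M a \<inter># values_mset M b"
    by (rule multiset_eqI) auto
  finally show ?thesis .
qed

section \<open>Strictly interlacing nodes\<close>

text \<open>
  The situation after the common values of two interlacing sequences have been cancelled. Strict
  interlacing \<open>b\<^sub>1 > a\<^sub>1 > b\<^sub>2 > a\<^sub>2 > \<dots>\<close> is expressed by counting, which avoids enumerating \<open>I\<close> and \<open>J\<close>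
  in order.
\<close>

locale interlacing_nodes =
  fixes I J :: "nat set" and a b :: "nat \<Rightarrow> real"
  assumes finite_I: "finite I" and finite_J: "finite J"
    and inj_a: "inj_on a I" and inj_b: "inj_on b J"
    and disjoint_values: "\<And>i j. i \<in> I \<Longrightarrow> j \<in> J \<Longrightarrow> a i \<noteq> b j"
    and card_eq: "card I = card J"
    and count_le: "\<And>P. up_closed P \<Longrightarrow> card {i \<in> I. P (a i)} \<le> card {j \<in> J. P (b j)}"
    and count_ge: "\<And>P. up_closed P \<Longrightarrow> card {j \<in> J. P (b j)} \<le> Suc (card {i \<in> I. P (a i)})"

text \<open>
  Cancelling equal values lowers the counts for \<open>a\<close> and for \<open>b\<close> by the same amount, so the counting
  form of interlacing survives.
\<close>

lemma interlacing_nodes_excess_indices: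
  assumes a: "antimono_on {..<M} a" and b: "antimono_on {..<M} b" and ab: "interlaces M a b"
  shows "interlacing_nodes (excess_indices M a b) (excess_indices M b a) a b"
proof -
  let ?I = "excess_indices M a b" and ?J = "excess_indices M b a"
  note mult = interlaces_imp_multiplicity[OF ab]
  have I: "image_mset a (mset_set ?I) = values_mset M a - values_mset M b"
    by (rule image_mset_excess_indices[OF a mult(1)])
  have J: "image_mset b (mset_set ?J) = values_mset M b - values_mset M a"
    by (rule image_mset_excess_indices[OF b mult(2)])
  have swap: "values_mset M a + (values_mset M b - values_mset M a) =
      values_mset M b + (values_mset M a - values_mset M b)"
    by (rule multiset_eqI) auto
  have count: "card {i \<in> ?I. P (a i)} + size (filter_mset P (values_mset M b)) =
      card {j \<in> ?J. P (b j)} + size (filter_mset P (values_mset M a))" for P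
    using arg_cong[OF swap, of "\<lambda>A. size (filter_mset P A)"]
    by (simp flip: I J add: size_filter_image_mset_set)
  show ?thesis
  proof
    show "inj_on a ?I" "inj_on b ?J" by (rule inj_on_excess_indices)+
    show "card ?I = card ?J" using count[of "\<lambda>_. True"] by simp
    show "a i \<noteq> b j" if "i \<in> ?I" "j \<in> ?J" for i j
      using that by (auto simp: excess_indices_def)
    fix P assume P: "up_closed P"
    show "card {i \<in> ?I. P (a i)} \<le> card {j \<in> ?J. P (b j)}"
      "card {j \<in> ?J. P (b j)} \<le> Suc (card {i \<in> ?I. P (a i)})"
      using count[of P] interlaces_imp_counts[OF ab P] by linarith+
  qed simp_all
qed

lemma sgn_prod_diff:
  fixes c :: "'i \<Rightarrow> real"
  assumes "finite S" and "\<And>k. k \<in> S \<Longrightarrow> c k \<noteq> x"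
  shows "sgn (\<Prod>k\<in>S. x - c k) = (-1) ^ card {k \<in> S. x < c k}"
  using assms
proof (induction S)
  case (insert s S)
  have "{k \<in> insert s S. x < c k} = (if x < c s then insert s {k \<in> S. x < c k} else {k \<in> S. x < c k})"
    by auto
  moreover have "sgn (x - c s) = (if x < c s then -1 else 1)"
    using insert.prems[of s] by (auto simp: sgn_if)
  ultimately show ?case using insert by (auto simp: sgn_mult)
qed simp

context interlacing_nodes
begin

text \<open>
  By the two counts at the threshold \<open>a m\<close>, strict and non-strict, exactly one more node of \<open>b\<close> than
  of \<open>a\<close> lies above \<open>a m\<close>. So numerator and denominator have opposite signs.
\<close>

lemma v_radicand_pos:
  assumes m: "m \<in> I"
  shows "0 < - ((\<Prod>k\<in>J. a m - b k) / (\<Prod>k\<in>I - {m}. a m - a k))"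
proof -
  let ?c = "card {k \<in> I - {m}. a m < a k}" and ?d = "card {j \<in> J. a m < b j}"
  have eq: "{k \<in> I - {m}. a m < a k} = {k \<in> I. a m < a k}" by auto
  have "{k \<in> I. a m \<le> a k} = insert m {k \<in> I. a m < a k}"
    using m inj_onD[OF inj_a _ m] by (auto simp: le_less)
  then have "card {k \<in> I. a m \<le> a k} = Suc ?c" using finite_I unfolding eq by simp
  moreover have "{j \<in> J. a m \<le> b j} = {j \<in> J. a m < b j}"
  proof (rule Collect_cong)
    fix j
    show "(j \<in> J \<and> a m \<le> b j) = (j \<in> J \<and> a m < b j)"
      using disjoint_values[OF m, of j] by auto
  qed
  ultimately have "?d = Suc ?c"
    using count_le[OF up_closed_ge[of "a m"]] count_ge[OF up_closed_greater[of "a m"]]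
    unfolding eq by simp
  moreover have "sgn (\<Prod>k\<in>J. a m - b k) = (-1) ^ ?d"
    by (intro sgn_prod_diff finite_J disjoint_values[OF m, THEN not_sym])
  moreover have "sgn (\<Prod>k\<in>I - {m}. a m - a k) = (-1) ^ ?c"
    using finite_I inj_onD[OF inj_a _ _ m] by (intro sgn_prod_diff) auto
  ultimately have "sgn ((\<Prod>k\<in>J. a m - b k) / (\<Prod>k\<in>I - {m}. a m - a k)) = -1"
    by simp
  then show ?thesis
    using sgn_less[of "(\<Prod>k\<in>J. a m - b k) / (\<Prod>k\<in>I - {m}. a m - a k)"] by simp
qed

text \<open>
  Here as many nodes of \<open>a\<close> as of \<open>b\<close> lie above \<open>b m\<close>, so the signs agree.
\<close>

lemma w_radicand_pos:
  assumes m: "m \<in> J"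
  shows "0 < (\<Prod>k\<in>I. b m - a k) / (\<Prod>k\<in>J - {m}. b m - b k)"
proof -
  let ?c = "card {k \<in> J - {m}. b m < b k}" and ?d = "card {i \<in> I. b m < a i}"
  have eq: "{k \<in> J - {m}. b m < b k} = {k \<in> J. b m < b k}" by auto
  have "{k \<in> J. b m \<le> b k} = insert m {k \<in> J. b m < b k}"
    using m inj_onD[OF inj_b _ m] by (auto simp: le_less)
  then have "card {k \<in> J. b m \<le> b k} = Suc ?c" using finite_J unfolding eq by simp
  moreover have "{i \<in> I. b m \<le> a i} = {i \<in> I. b m < a i}"
    using disjoint_values[OF _ m] by (force simp: le_less)
  ultimately have "?d = ?c"
    using count_le[OF up_closed_greater[of "b m"]] count_ge[OF up_closed_ge[of "b m"]]
    unfolding eq by simp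
  moreover have "sgn (\<Prod>k\<in>I. b m - a k) = (-1) ^ ?d"
    using disjoint_values[OF _ m] by (intro sgn_prod_diff finite_I) auto
  moreover have "sgn (\<Prod>k\<in>J - {m}. b m - b k) = (-1) ^ ?c"
    using finite_J inj_onD[OF inj_b _ _ m] by (intro sgn_prod_diff) auto
  ultimately have "sgn ((\<Prod>k\<in>I. b m - a k) / (\<Prod>k\<in>J - {m}. b m - b k)) = 1"
    by (simp flip: power_add)
  then show ?thesis by (simp add: sgn_if split: if_splits)
qed

end

section \<open>Partial fractions and the Cauchy matrix\<close>

lemma linear_factors_monic:
  fixes c :: "'i \<Rightarrow> 'a::idom"
  assumes "finite S"
  shows "degree (\<Prod>k\<in>S. [:- c k, 1:]) = card S" and "lead_coeff (\<Prod>k\<in>S. [:- c k, 1:]) = 1"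
proof -
  show "degree (\<Prod>k\<in>S. [:- c k, 1:]) = card S"
    using assms by (subst degree_prod_eq_sum_degree) auto
  show "lead_coeff (\<Prod>k\<in>S. [:- c k, 1:]) = 1"
    by (intro monic_prod) auto
qed

lemma poly_linear_factors:
  fixes c :: "'i \<Rightarrow> 'a::idom"
  shows "poly (\<Prod>k\<in>S. [:- c k, 1:]) x = (\<Prod>k\<in>S. x - c k)"
  by (simp add: poly_prod)

lemma lagrange_interpolation:
  fixes a :: "'i \<Rightarrow> real"
  assumes fin: "finite I" and inj: "inj_on a I" and deg: "degree q < card I"
  shows "poly q x = (\<Sum>i\<in>I. poly q (a i) * (\<Prod>k\<in>I - {i}. x - a k) / (\<Prod>k\<in>I - {i}. a i - a k))"
proof -
  let ?d = "\<lambda>i. \<Prod>k\<in>I - {i}. a i - a k"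
  define p where "p = (\<Sum>i\<in>I. smult (poly q (a i) / ?d i) (\<Prod>k\<in>I - {i}. [:- a k, 1:]))"
  have d: "?d i \<noteq> 0" if "i \<in> I" for i
    using fin inj that by (auto dest: inj_onD)
  have "q = p"
  proof (rule poly_eqI_degree)
    have "degree p \<le> card I - 1"
      unfolding p_def
      by (intro degree_sum_le fin order_trans[OF degree_smult_le])
        (simp add: linear_factors_monic(1) fin)
    then show "degree p < card (a ` I)" using deg inj by (simp add: card_image)
    show "degree q < card (a ` I)" using deg inj by (simp add: card_image)
    fix y assume "y \<in> a ` I"
    then obtain j where j: "j \<in> I" "y = a j" by auto
    have "poly p y = (\<Sum>i\<in>I. poly q (a i) / ?d i * (\<Prod>k\<in>I - {i}. y - a k))"
      by (simp add: p_def poly_sum poly_linear_factors)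
    also have "\<dots> = (\<Sum>i\<in>I. if i = j then poly q y else 0)"
    proof (rule sum.cong)
      fix i assume i: "i \<in> I"
      have "(\<Prod>k\<in>I - {i}. y - a k) = 0" if "i \<noteq> j"
        using fin j that by (intro prod_zero) auto
      then show "poly q (a i) / ?d i * (\<Prod>k\<in>I - {i}. y - a k) = (if i = j then poly q y else 0)"
        using d[OF i] j by auto
    qed simp
    also have "\<dots> = poly q y" using j fin by simp
    finally show "poly q y = poly p y" by simp
  qed
  then have "poly q x = poly p x" by simp
  then show ?thesis by (simp add: p_def poly_sum poly_linear_factors)
qed

lemma partial_fractions:
  fixes a :: "'i \<Rightarrow> real"
  assumes fin: "finite I" and inj: "inj_on a I" and deg: "degree q < card I"
    and x: "\<And>i. i \<in> I \<Longrightarrow> a i \<noteq> x"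
  shows "poly q x / (\<Prod>k\<in>I. x - a k) =
    (\<Sum>i\<in>I. poly q (a i) / (\<Prod>k\<in>I - {i}. a i - a k) / (x - a i))"
proof -
  have "poly q (a i) * (\<Prod>k\<in>I - {i}. x - a k) / (\<Prod>k\<in>I - {i}. a i - a k) / (\<Prod>k\<in>I. x - a k)
    = poly q (a i) / (\<Prod>k\<in>I - {i}. a i - a k) / (x - a i)" if i: "i \<in> I" for i
  proof -
    have "(\<Prod>k\<in>I. x - a k) = (x - a i) * (\<Prod>k\<in>I - {i}. x - a k)"
      using fin i by (rule prod.remove)
    moreover have "(\<Prod>k\<in>I - {i}. x - a k) \<noteq> 0" using fin x by fastforce
    ultimately show ?thesis by simp
  qed
  then show ?thesis
    unfolding lagrange_interpolation[OF fin inj deg, of x] sum_divide_distrib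
    by (intro sum.cong) auto
qed

text \<open>
  The leading terms cancel, which is what makes partial fractions applicable.
\<close>

lemma degree_diff_linear_factors:
  fixes a b :: "nat \<Rightarrow> 'a::idom"
  assumes "finite I" "finite J" "card I = card J" "I \<noteq> {}"
  shows "degree ((\<Prod>k\<in>I. [:- a k, 1:]) - (\<Prod>k\<in>J. [:- b k, 1:])) < card I"
proof -
  let ?p = "\<Prod>k\<in>I. [:- a k, 1:]" and ?q = "\<Prod>k\<in>J. [:- b k, 1:]"
  have "degree (?p - ?q) \<le> card I"
    by (intro degree_diff_le) (simp_all only: linear_factors_monic(1) assms(1,2,3) order_refl)
  moreover have "coeff (?p - ?q) (card I) = 0"
    using linear_factors_monic[OF assms(1), of a] linear_factors_monic[OF assms(2), of b] assms(3)
    by simp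
  moreover have "card I > 0" using assms(1,4) by (simp add: card_gt_0_iff)
  ultimately show ?thesis
    by (metis degree_0 leading_coeff_0_iff le_neq_implies_less)
qed

context interlacing_nodes
begin

lemma v_square: "m \<in> I \<Longrightarrow> (v_entry I J a b m)\<^sup>2 = - ((\<Prod>k\<in>J. a m - b k) / (\<Prod>k\<in>I - {m}. a m - a k))"
  unfolding v_entry_def using v_radicand_pos[of m] by (intro real_sqrt_pow2) simp

lemma w_square: "m \<in> J \<Longrightarrow> (w_entry I J a b m)\<^sup>2 = (\<Prod>k\<in>I. b m - a k) / (\<Prod>k\<in>J - {m}. b m - b k)"
  unfolding w_entry_def using w_radicand_pos[of m] by (intro real_sqrt_pow2) simp

text \<open>
  Partial fractions for \<open>(p\<^sub>I - p\<^sub>J) / p\<^sub>I\<close>, where \<open>p\<^sub>I\<close> and \<open>p\<^sub>J\<close> are the monic polynomials with roots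
  \<open>a\<close> on \<open>I\<close> and \<open>b\<close> on \<open>J\<close>: the residue at \<open>a\<^sub>i\<close> is \<open>v\<^sub>i\<^sup>2\<close>, and the quotient is \<open>1\<close> at every root of \<open>p\<^sub>J\<close>.
\<close>

lemma secular_equation:
  assumes j: "j \<in> J"
  shows "(\<Sum>i\<in>I. (v_entry I J a b i)\<^sup>2 / (b j - a i)) = 1"
proof -
  let ?q = "(\<Prod>k\<in>I. [:- a k, 1:]) - (\<Prod>k\<in>J. [:- b k, 1:])"
  have "I \<noteq> {}" using j finite_J card_eq by auto
  then have deg: "degree ?q < card I"
    using finite_I finite_J card_eq by (intro degree_diff_linear_factors)
  have qb: "poly ?q (b j) = (\<Prod>k\<in>I. b j - a k)"
    using j finite_J by (auto simp: poly_linear_factors intro: prod_zero)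
  have qa: "poly ?q (a i) = - (\<Prod>k\<in>J. a i - b k)" if "i \<in> I" for i
    using that finite_I by (auto simp: poly_linear_factors intro: prod_zero)
  have "(\<Prod>k\<in>I. b j - a k) \<noteq> 0" using finite_I disjoint_values[OF _ j] by force
  then have "1 = poly ?q (b j) / (\<Prod>k\<in>I. b j - a k)" unfolding qb by simp
  also have "\<dots> = (\<Sum>i\<in>I. poly ?q (a i) / (\<Prod>k\<in>I - {i}. a i - a k) / (b j - a i))"
    using disjoint_values[OF _ j] by (intro partial_fractions finite_I inj_a deg) auto
  also have "\<dots> = (\<Sum>i\<in>I. (v_entry I J a b i)\<^sup>2 / (b j - a i))"
  proof (intro sum.cong refl)
    fix i assume i: "i \<in> I"
    show "poly ?q (a i) / (\<Prod>k\<in>I - {i}. a i - a k) / (b j - a i) =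
        (v_entry I J a b i)\<^sup>2 / (b j - a i)"
      unfolding qa[OF i] v_square[OF i] by simp
  qed
  finally show ?thesis by simp
qed

text \<open>
  Partial fractions for \<open>q / p\<^sub>I\<close> with \<open>q = p\<^sub>J / (x - b\<^sub>j)\<close>, evaluated at \<open>b\<^sub>l\<close>. For \<open>l \<noteq> j\<close> the value is
  \<open>0\<close>; for \<open>l = j\<close> it is \<open>1 / w\<^sub>j\<^sup>2\<close>. This treats diagonal and off-diagonal entries of the Gram matrix
  alike, without differentiating \<open>p\<^sub>J / p\<^sub>I\<close>.
\<close>

lemma cauchy_gram:
  assumes j: "j \<in> J" and l: "l \<in> J"
  shows "(\<Sum>i\<in>I. (v_entry I J a b i)\<^sup>2 / ((b j - a i) * (b l - a i))) =
    (\<Prod>k\<in>J - {j}. b l - b k) / (\<Prod>k\<in>I. b l - a k)"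
proof -
  let ?q = "\<Prod>k\<in>J - {j}. [:- b k, 1:]"
  have "card I > 0" using j finite_J card_eq by (auto simp: card_gt_0_iff)
  then have deg: "degree ?q < card I"
    using finite_J card_eq j by (simp add: linear_factors_monic)
  have term_eq: "poly ?q (a i) / (\<Prod>k\<in>I - {i}. a i - a k) / (b l - a i) =
      (v_entry I J a b i)\<^sup>2 / ((b j - a i) * (b l - a i))" if i: "i \<in> I" for i
  proof -
    have "(\<Prod>k\<in>J. a i - b k) = (a i - b j) * poly ?q (a i)"
      using finite_J j by (simp add: poly_linear_factors prod.remove)
    moreover have "a i - b j \<noteq> 0" using disjoint_values[OF i j] by simp
    ultimately have "poly ?q (a i) = - (\<Prod>k\<in>J. a i - b k) / (b j - a i)"
      by (simp add: field_simps)
    then show ?thesis by (simp add: v_square[OF i])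
  qed
  have "(\<Sum>i\<in>I. (v_entry I J a b i)\<^sup>2 / ((b j - a i) * (b l - a i))) =
      (\<Sum>i\<in>I. poly ?q (a i) / (\<Prod>k\<in>I - {i}. a i - a k) / (b l - a i))"
    by (intro sum.cong refl term_eq[symmetric])
  also have "\<dots> = poly ?q (b l) / (\<Prod>k\<in>I. b l - a k)"
    using disjoint_values[OF _ l] by (intro partial_fractions[symmetric] finite_I inj_a deg) auto
  finally show ?thesis by (simp add: poly_linear_factors)
qed

lemma cauchy_orthonormal:
  assumes j: "j \<in> J" and l: "l \<in> J"
  shows "(\<Sum>i\<in>I. (v_entry I J a b i * w_entry I J a b j / (b j - a i)) *
      (v_entry I J a b i * w_entry I J a b l / (b l - a i))) = (if j = l then 1 else 0)"
proof -
  have "(\<Sum>i\<in>I. (v_entry I J a b i * w_entry I J a b j / (b j - a i)) *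
      (v_entry I J a b i * w_entry I J a b l / (b l - a i))) =
    w_entry I J a b j * w_entry I J a b l *
      (\<Sum>i\<in>I. (v_entry I J a b i)\<^sup>2 / ((b j - a i) * (b l - a i)))"
    unfolding sum_distrib_left by (intro sum.cong) (simp_all add: power2_eq_square)
  also have "\<dots> = w_entry I J a b j * w_entry I J a b l *
      ((\<Prod>k\<in>J - {j}. b l - b k) / (\<Prod>k\<in>I. b l - a k))"
    by (simp add: cauchy_gram[OF j l])
  also have "\<dots> = (if j = l then 1 else 0)"
  proof (cases "j = l")
    case True
    have "w_entry I J a b j * w_entry I J a b j =
        (\<Prod>k\<in>I. b j - a k) / (\<Prod>k\<in>J - {j}. b j - b k)"
      using w_square[OF j] by (simp add: power2_eq_square)
    then show ?thesis using w_radicand_pos[OF j] True by auto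
  next
    case False
    then have "(\<Prod>k\<in>J - {j}. b l - b k) = 0"
      using finite_J l by (intro prod_zero) auto
    then show ?thesis using False by simp
  qed
  finally show ?thesis .
qed

lemma cauchy_column_dot_v:
  assumes j: "j \<in> J"
  shows "(\<Sum>i\<in>I. v_entry I J a b i * (v_entry I J a b i * w_entry I J a b j / (b j - a i))) =
    w_entry I J a b j"
proof -
  have "(\<Sum>i\<in>I. v_entry I J a b i * (v_entry I J a b i * w_entry I J a b j / (b j - a i))) =
      w_entry I J a b j * (\<Sum>i\<in>I. (v_entry I J a b i)\<^sup>2 / (b j - a i))"
    unfolding sum_distrib_left by (intro sum.cong) (simp_all add: power2_eq_square)
  then show ?thesis by (simp add: secular_equation[OF j])
qed

end

section \<open>Roots of the secular polynomial\<close>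

text \<open>
  The polynomial \<open>D\<close> in the proof is the characteristic polynomial of the diagonal matrix of the
  \<open>a\<^sub>k\<close> plus the rank-one matrix with squared coefficients \<open>c\<^sub>k\<close>. Its value at \<open>a\<^sub>k\<close> has sign \<open>- (-1)\<^sup>j\<close>,
  where \<open>j\<close> is the number of earlier indices, so there is a root between neighbouring \<open>a\<^sub>k\<close> and one
  more above the largest.
\<close>

lemma secular_roots:
  fixes a c :: "nat \<Rightarrow> real"
  assumes fin: "finite K" and dec: "\<And>k l. k \<in> K \<Longrightarrow> l \<in> K \<Longrightarrow> k < l \<Longrightarrow> a l < a k"
    and pos: "\<And>k. k \<in> K \<Longrightarrow> 0 < c k"
  obtains r where "\<And>k. k \<in> K \<Longrightarrow> a k < r k"
    and "\<And>k l. k \<in> K \<Longrightarrow> l \<in> K \<Longrightarrow> k < l \<Longrightarrow> r l < a k"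
    and "\<And>k. k \<in> K \<Longrightarrow> (\<Prod>l\<in>K. a k - r l) = - c k * (\<Prod>l\<in>K - {k}. a k - a l)"
proof -
  define P where "P = (\<Prod>l\<in>K. [:- a l, 1:])"
  define Q where "Q = (\<Sum>k\<in>K. smult (c k) (\<Prod>l\<in>K - {k}. [:- a l, 1:]))"
  define D where "D = P - Q"
  have inj: "inj_on a K"
  proof (rule inj_onI)
    fix k l assume "k \<in> K" "l \<in> K" "a k = a l"
    then show "k = l" using dec[of k l] dec[of l k] by (cases k l rule: linorder_cases) auto
  qed
  have value_at: "poly D (a k) = - c k * (\<Prod>l\<in>K - {k}. a k - a l)" if k: "k \<in> K" for k
  proof -
    have "poly P (a k) = 0"
      using fin k by (auto simp: P_def poly_linear_factors)
    moreover have "poly Q (a k) = (\<Sum>i\<in>K. c i * (\<Prod>l\<in>K - {i}. a k - a l))"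
      by (simp add: Q_def poly_sum poly_linear_factors)
    moreover have "(\<Sum>i\<in>K. c i * (\<Prod>l\<in>K - {i}. a k - a l)) =
        (\<Sum>i\<in>K. if i = k then c k * (\<Prod>l\<in>K - {k}. a k - a l) else 0)"
    proof (rule sum.cong)
      fix i assume "i \<in> K"
      have "(\<Prod>l\<in>K - {i}. a k - a l) = 0" if "i \<noteq> k"
        using that fin k by (intro prod_zero) auto
      then show "c i * (\<Prod>l\<in>K - {i}. a k - a l) =
          (if i = k then c k * (\<Prod>l\<in>K - {k}. a k - a l) else 0)" by auto
    qed simp
    ultimately show ?thesis using fin k by (simp add: D_def)
  qed
  have sgn_at: "sgn (poly D (a k)) = - ((-1) ^ card {l \<in> K. l < k})" if k: "k \<in> K" for k
  proof -
    have "sgn (\<Prod>l\<in>K - {k}. a k - a l) = (-1) ^ card {l \<in> K - {k}. a k < a l}"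
      using fin inj_onD[OF inj _ _ k] by (intro sgn_prod_diff) auto
    also have "{l \<in> K - {k}. a k < a l} = {l \<in> K. l < k}"
    proof (rule Collect_cong)
      fix l
      show "(l \<in> K - {k} \<and> a k < a l) = (l \<in> K \<and> l < k)"
        using dec[OF _ k, of l] dec[OF k, of l] by (cases l k rule: linorder_cases) auto
    qed
    finally show ?thesis using pos[OF k] unfolding value_at[OF k] by (simp add: sgn_mult)
  qed
  have deg_P: "degree P = card K" and lead_P: "coeff P (card K) = 1"
    using linear_factors_monic[OF fin, of a] by (simp_all add: P_def)
  have coeff_Q: "coeff Q n = 0" if n: "card K \<le> n" for n
    unfolding Q_def coeff_sum
  proof (intro sum.neutral ballI)
    fix k assume k: "k \<in> K"
    then have "card K > 0" using fin by (auto simp: card_gt_0_iff)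
    then have "degree (\<Prod>l\<in>K - {k}. [:- a l, 1:]) < n"
      using fin k n by (simp add: linear_factors_monic(1))
    then show "coeff (smult (c k) (\<Prod>l\<in>K - {k}. [:- a l, 1:])) n = 0"
      by (simp add: coeff_eq_0)
  qed
  have deg_PQ: "degree D \<le> card K"
    by (rule degree_le) (auto simp: D_def coeff_Q deg_P coeff_eq_0)
  have lead_PQ: "coeff D (card K) = 1"
    by (simp add: D_def coeff_Q lead_P)
  have "degree D = card K"
    using deg_PQ lead_PQ by (metis le_antisym le_degree zero_neq_one)
  then have lead: "lead_coeff D = 1" using lead_PQ by simp
  have "\<exists>x. a k < x \<and> (\<forall>l\<in>K. l < k \<longrightarrow> x < a l) \<and> poly D x = 0" if k: "k \<in> K" for k
  proof (cases "{l \<in> K. l < k} = {}")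
    case True
    then have "sgn (poly D (a k)) = -1" using sgn_at[OF k] by (simp only: card.empty) simp
    then have neg: "poly D (a k) < 0" by (simp add: sgn_if split: if_splits)
    obtain n where n: "\<And>x. n \<le> x \<Longrightarrow> 1 \<le> poly D x"
      using poly_pinfty_gt_lc[of "D"] lead by auto
    have "a k < max n (a k + 1)" "0 < poly D (max n (a k + 1))"
      using n[of "max n (a k + 1)"] by (simp_all add: less_max_iff_disj)
    from poly_IVT_pos[OF this(1) neg this(2)] obtain x where "a k < x" "poly D x = 0" by blast
    then show ?thesis using True by blast
  next
    case False
    \<comment> \<open>\<open>a k'\<close> is the neighbour of \<open>a k\<close> from above, and \<open>D\<close> has opposite signs at the two.\<close>
    define k' where "k' = Max {l \<in> K. l < k}"
    have k': "k' \<in> K" "k' < k" and max: "\<And>l. l \<in> K \<Longrightarrow> l < k \<Longrightarrow> l \<le> k'"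
      using Max_in[of "{l \<in> K. l < k}"] False fin by (auto simp: k'_def)
    have "{l \<in> K. l < k} = insert k' {l \<in> K. l < k'}"
      using k' max by force
    then have "card {l \<in> K. l < k} = Suc (card {l \<in> K. l < k'})" using fin by simp
    then have "sgn (poly D (a k) * poly D (a k')) = -1"
      using sgn_at[OF k] sgn_at[OF k'(1)] by (simp add: sgn_mult flip: power_add)
    then have "poly D (a k) * poly D (a k') < 0"
      using sgn_less[of "poly D (a k) * poly D (a k')"] by simp
    then obtain x where x: "a k < x" "x < a k'" "poly D x = 0"
      using poly_IVT[of "a k" "a k'" "D"] dec[OF k'(1) k k'(2)] by auto
    have "x < a l" if "l \<in> K" "l < k" for l
      using max[OF that] dec[OF that(1) k'(1)] x by (cases "l = k'") auto
    with x show ?thesis by blast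
  qed
  then obtain r where r: "\<And>k. k \<in> K \<Longrightarrow> a k < r k" "\<And>k l. k \<in> K \<Longrightarrow> l \<in> K \<Longrightarrow> l < k \<Longrightarrow> r k < a l"
    "\<And>k. k \<in> K \<Longrightarrow> poly D (r k) = 0"
    by metis
  \<comment> \<open>The roots found are distinct and as many as the degree, so they give the full factorization of \<open>D\<close>.\<close>
  have inj_r: "inj_on r K"
  proof (rule inj_onI)
    fix k l assume "k \<in> K" "l \<in> K" "r k = r l"
    then show "k = l" using r(1)[of k] r(2)[of l k] r(1)[of l] r(2)[of k l]
      by (cases k l rule: linorder_cases) auto
  qed
  have "D = (\<Prod>l\<in>K. [:- r l, 1:])"
  proof (rule poly_eqI_degree_lead_coeff[where n = "card K" and A = "r ` K"])
    show "coeff D (card K) = coeff (\<Prod>l\<in>K. [:- r l, 1:]) (card K)"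
      using linear_factors_monic[OF fin, of r] by (simp add: lead_PQ)
    show "card K \<le> card (r ` K)" by (simp add: card_image[OF inj_r])
    show "degree (\<Prod>l\<in>K. [:- r l, 1:]) \<le> card K" by (simp add: linear_factors_monic(1)[OF fin])
    show "poly D z = poly (\<Prod>l\<in>K. [:- r l, 1:]) z" if "z \<in> r ` K" for z
      using that r(3) fin by (auto simp: poly_linear_factors)
  qed (rule deg_PQ)
  then have "(\<Prod>l\<in>K. a k - r l) = poly D (a k)" for k
    by (simp add: poly_linear_factors)
  then show ?thesis using that[of r] r value_at by auto
qed

section \<open>Real and complex scalars\<close>

text \<open>
  All that is used of the scalars: conjugation fixes the reals, and \<open>x\<close> times its conjugate is a
  nonnegative real. Within the axioms, \<open>r *\<^sub>R 1\<close> is the embedded real \<open>r\<close>.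
\<close>

class real_or_complex = conjugatable_field + real_field +
  assumes conjugate_scaleR_one: "conjugate (r *\<^sub>R 1) = r *\<^sub>R 1"
    and mult_conjugate_nonneg: "\<exists>r\<ge>0. x * conjugate x = r *\<^sub>R 1"

instance real :: real_or_complex
  by standard auto

instance complex :: real_or_complex
proof
  fix x :: complex
  have "x * conjugate x = (cmod x)\<^sup>2 *\<^sub>R 1"
    using complex_norm_square[of x] by (simp add: scaleR_conv_of_real)
  then show "\<exists>r\<ge>0. x * conjugate x = r *\<^sub>R 1" by (intro exI[of _ "(cmod x)\<^sup>2"]) simp
qed (simp add: scaleR_conv_of_real)

lemma conjugate_of_real [simp]: "conjugate (of_real r :: 'a::real_or_complex) = of_real r"
  by (simp add: of_real_def conjugate_scaleR_one)

lemma conjugate_one [simp]: "conjugate (1 :: 'a::real_or_complex) = 1"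
  using conjugate_of_real[of 1, where 'a = 'a] by simp

lemma conjugate_diff: "conjugate (x - y :: 'a::conjugatable_field) = conjugate x - conjugate y"
  using conjugate_dist_add[of x "- y"] by (simp add: conjugate_neg)

definition norm_sq :: "'a::real_or_complex \<Rightarrow> real"
  where "norm_sq x = (SOME r. 0 \<le> r \<and> x * conjugate x = of_real r)"

lemma norm_sq_nonneg: "0 \<le> norm_sq x" and mult_conjugate: "x * conjugate x = of_real (norm_sq x)"
proof -
  have "\<exists>r. 0 \<le> r \<and> x * conjugate x = of_real r"
    using mult_conjugate_nonneg[of x] by (auto simp: of_real_def)
  from someI_ex[OF this] show "0 \<le> norm_sq x" "x * conjugate x = of_real (norm_sq x)"
    by (simp_all add: norm_sq_def)
qed

lemma norm_sq_eq_0 [simp]: "norm_sq x = 0 \<longleftrightarrow> x = 0"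
  using mult_conjugate[of x] conjugate_square_eq_0(1)[of x]
  by (metis of_real_eq_0_iff)

text \<open>
  The phase \<open>\<phi>\<close> lets a Householder reflection, which requires the first entry of its target to be
  real, reach an arbitrary vector.
\<close>

lemma polar_form:
  fixes x :: "'a::real_or_complex"
  obtains \<phi> c where "0 \<le> c" and "x = \<phi> * of_real c" and "\<phi> * conjugate \<phi> = 1"
proof (cases "x = 0")
  case True
  then show ?thesis using that[of 0 1] by simp
next
  case False
  define c where "c = sqrt (norm_sq x)"
  have c: "0 < c" "c * c = norm_sq x"
    using False norm_sq_nonneg[of x] norm_sq_eq_0[of x] by (simp_all add: c_def less_le)
  let ?\<phi> = "x * of_real (1 / c)"
  have "conjugate ?\<phi> = conjugate x * of_real (1 / c)"
    by (simp only: conjugate_dist_mul conjugate_of_real)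
  then have "?\<phi> * conjugate ?\<phi> = (x * conjugate x) * of_real (1 / c * (1 / c))"
    by (simp only: of_real_mult mult_ac)
  also have "\<dots> = of_real (c * c * (1 / c * (1 / c)))"
    by (simp only: mult_conjugate c(2) of_real_mult)
  also have "\<dots> = 1" using c(1) by (simp add: field_simps)
  finally have "?\<phi> * conjugate ?\<phi> = 1" .
  moreover have "x = ?\<phi> * of_real c" using c(1) by simp
  ultimately show ?thesis using that[of c ?\<phi>] c(1) by simp
qed

section \<open>Adjoints and unitary matrices\<close>

lemma dim_mat_adjoint [simp]:
  "dim_row (mat_adjoint A) = dim_col A" "dim_col (mat_adjoint A) = dim_row A"
  by (simp_all add: mat_adjoint_def)

lemma mat_adjoint_eq:
  "A \<in> carrier_mat n m \<Longrightarrow> mat_adjoint A = mat m n (\<lambda>(i, j). conjugate (A $$ (j, i)))"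
  by (rule eq_matI) (auto simp: mat_adjoint_def mat_of_rows_def)

lemma mat_adjoint_carrier [simp]: "A \<in> carrier_mat n m \<Longrightarrow> mat_adjoint A \<in> carrier_mat m n"
  by (simp add: mat_adjoint_eq)

lemma mat_adjoint_mult:
  assumes A: "A \<in> carrier_mat n m" and B: "B \<in> carrier_mat m l"
  shows "mat_adjoint (A * B) = mat_adjoint B * mat_adjoint A"
proof (rule eq_matI)
  fix i j assume "i < dim_row (mat_adjoint B * mat_adjoint A)" "j < dim_col (mat_adjoint B * mat_adjoint A)"
  then have "i < l" "j < n" using mat_adjoint_carrier[OF A] mat_adjoint_carrier[OF B] by auto
  then show "mat_adjoint (A * B) $$ (i, j) = (mat_adjoint B * mat_adjoint A) $$ (i, j)"
    using A B by (simp add: mat_adjoint_eq[OF mult_carrier_mat[OF A B]] mat_adjoint_eq[OF A]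
        mat_adjoint_eq[OF B] scalar_prod_def sum_conjugate conjugate_dist_mul mult.commute)
qed (use A B mat_adjoint_carrier[OF A] mat_adjoint_carrier[OF B]
      mat_adjoint_carrier[OF mult_carrier_mat[OF A B]] in auto)

text \<open>
  For square matrices a left inverse is a right inverse, so orthonormal columns suffice.
\<close>

lemma unitary_mat_iff_columns:
  assumes U: "U \<in> carrier_mat M M"
  shows "unitary_mat M U \<longleftrightarrow>
    (\<forall>i<M. \<forall>j<M. (\<Sum>k<M. conjugate (U $$ (k, i)) * U $$ (k, j)) = (if i = j then 1 else 0))"
    (is "_ \<longleftrightarrow> ?cols")
proof -
  have U': "mat_adjoint U \<in> carrier_mat M M" using U by simp
  have entry: "(mat_adjoint U * U) $$ (i, j) = (\<Sum>k<M. conjugate (U $$ (k, i)) * U $$ (k, j))"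
    if "i < M" "j < M" for i j
    using that U by (simp add: mat_adjoint_eq[OF U] scalar_prod_def lessThan_atLeast0)
  have "mat_adjoint U * U = 1\<^sub>m M \<longleftrightarrow> ?cols"
  proof
    assume "mat_adjoint U * U = 1\<^sub>m M"
    then show ?cols using entry by auto
  next
    assume ?cols
    then show "mat_adjoint U * U = 1\<^sub>m M"
      using U U' entry by (intro eq_matI) auto
  qed
  then show ?thesis
    unfolding unitary_mat_def using U U' mat_mult_left_right_inverse[OF U' U] by auto
qed

lemma unitary_mat_mult:
  assumes A: "unitary_mat M A" and B: "unitary_mat M B"
  shows "unitary_mat M (A * B)"
proof -
  have c: "A \<in> carrier_mat M M" "B \<in> carrier_mat M M" using A B by (auto simp: unitary_mat_def)
  note c' = mat_adjoint_carrier[OF c(1)] mat_adjoint_carrier[OF c(2)]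
  have "A * B * (mat_adjoint B * mat_adjoint A) = A * (B * mat_adjoint B) * mat_adjoint A"
    using c c' by (simp add: assoc_mult_mat[of _ M M _ M _ M] mult_carrier_mat[of _ M M])
  then have 1: "A * B * (mat_adjoint B * mat_adjoint A) = 1\<^sub>m M"
    using A B c by (simp add: unitary_mat_def)
  have "mat_adjoint B * mat_adjoint A * (A * B) = mat_adjoint B * (mat_adjoint A * A) * B"
    using c c' by (simp add: assoc_mult_mat[of _ M M _ M _ M] mult_carrier_mat[of _ M M])
  then have 2: "mat_adjoint B * mat_adjoint A * (A * B) = 1\<^sub>m M"
    using A B c c' by (simp add: unitary_mat_def)
  show ?thesis
    using c 1 2 by (auto simp: unitary_mat_def mat_adjoint_mult[OF c])
qed

section \<open>Frame operators and rank-one updates\<close>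

definition outer_product :: "'a::conjugatable_field vec \<Rightarrow> 'a mat"
  where "outer_product g = mat (dim_vec g) (dim_vec g) (\<lambda>(i, j). g $ i * conjugate (g $ j))"

lemma outer_product_carrier [simp]: "g \<in> carrier_vec M \<Longrightarrow> outer_product g \<in> carrier_mat M M"
  by (auto simp: outer_product_def)

lemma dim_outer_product [simp]:
  "dim_row (outer_product g) = dim_vec g" "dim_col (outer_product g) = dim_vec g"
  by (simp_all add: outer_product_def)

lemma frame_operator_eq:
  "frame_operator M n f = mat M M (\<lambda>(i, j). \<Sum>k<n. f (Suc k) $ i * conjugate (f (Suc k) $ j))"
proof -
  define F where "F = mat_of_cols M (map f [1..<Suc n])"
  have F: "F \<in> carrier_mat M n"
    using mat_of_cols_carrier(1)[of M "map f [1..<Suc n]"] by (simp add: F_def del: upt_Suc)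
  have "F $$ (i, k) = f (Suc k) $ i" if "i < M" "k < n" for i k
    using that unfolding F_def by (subst mat_of_cols_index) (simp_all del: upt_Suc)
  then show ?thesis
    unfolding frame_operator_def Let_def F_def[symmetric] using F
    by (intro eq_matI) (auto simp: mat_adjoint_eq[OF F] scalar_prod_def lessThan_atLeast0)
qed

lemma frame_operator_carrier [simp]: "frame_operator M n f \<in> carrier_mat M M"
  by (simp add: frame_operator_eq)

lemma frame_operator_Suc:
  assumes "f (Suc n) \<in> carrier_vec M"
  shows "frame_operator M (Suc n) f = frame_operator M n f + outer_product (f (Suc n))"
  using assms by (intro eq_matI) (auto simp: frame_operator_eq outer_product_def)

text \<open>
  A change of basis takes a rank-one update to a rank-one update.
\<close>

lemma outer_product_mult_mat_vec:
  assumes Q: "Q \<in> carrier_mat M M" and g: "g \<in> carrier_vec M"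
  shows "outer_product (Q *\<^sub>v g) = Q * outer_product g * mat_adjoint Q"
proof (rule eq_matI)
  have c: "outer_product g \<in> carrier_mat M M" "mat_adjoint Q \<in> carrier_mat M M"
    using Q g by simp_all
  show "dim_row (outer_product (Q *\<^sub>v g)) = dim_row (Q * outer_product g * mat_adjoint Q)"
    "dim_col (outer_product (Q *\<^sub>v g)) = dim_col (Q * outer_product g * mat_adjoint Q)"
    using Q g c by (auto simp: outer_product_def)
  fix i j
  assume "i < dim_row (Q * outer_product g * mat_adjoint Q)"
    "j < dim_col (Q * outer_product g * mat_adjoint Q)"
  then have ij: "i < M" "j < M" using Q c by auto
  have *: "(Q * outer_product g) $$ (i, k) = (Q *\<^sub>v g) $ i * conjugate (g $ k)" if "k < M" for k
    using that ij Q g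
    by (simp add: outer_product_def scalar_prod_def sum_distrib_right mult.assoc)
  have "(Q * outer_product g * mat_adjoint Q) $$ (i, j) =
      (\<Sum>k<M. (Q * outer_product g) $$ (i, k) * conjugate (Q $$ (j, k)))"
    using ij Q carrier_matD[OF c(1)]
    by (subst index_mult_mat(1))
      (auto simp: mat_adjoint_eq[OF Q] scalar_prod_def lessThan_atLeast0 intro!: sum.cong)
  also have "\<dots> = (Q *\<^sub>v g) $ i * (\<Sum>k<M. conjugate (g $ k) * conjugate (Q $$ (j, k)))"
    by (simp add: * sum_distrib_left mult.assoc)
  also have "(\<Sum>k<M. conjugate (g $ k) * conjugate (Q $$ (j, k))) = conjugate ((Q *\<^sub>v g) $ j)"
    using ij Q g by (simp add: scalar_prod_def sum_conjugate conjugate_dist_mul lessThan_atLeast0 mult.commute)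
  finally show "outer_product (Q *\<^sub>v g) $$ (i, j) = (Q * outer_product g * mat_adjoint Q) $$ (i, j)"
    using ij Q by (simp add: outer_product_def)
qed

section \<open>Sorting permutations\<close>

lemma sorting_perm:
  assumes "S \<subseteq> {..<M}"
  shows "is_sorting_perm M S (sorting_perm M S)"
  unfolding sorting_perm_def by (rule theI'[OF ex1_is_sorting_perm[OF assms]])

lemma sorting_perm_image:
  assumes S: "S \<subseteq> {..<M}"
  shows "sorting_perm M S ` S = {..<card S}"
proof -
  have p: "is_sorting_perm M S (sorting_perm M S)" by (rule sorting_perm[OF S])
  then have "inj (sorting_perm M S)" by (auto simp: is_sorting_perm_def intro: permutes_inj)
  then have "card (sorting_perm M S ` S) = card S" by (simp add: card_image inj_on_subset)
  then show ?thesis using p by (intro card_subset_eq) (auto simp: is_sorting_perm_def)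
qed

lemma sorting_perm_less_iff:
  assumes S: "S \<subseteq> {..<M}"
  shows "sorting_perm M S m < card S \<longleftrightarrow> m \<in> S"
proof
  have p: "is_sorting_perm M S (sorting_perm M S)" by (rule sorting_perm[OF S])
  show "m \<in> S \<Longrightarrow> sorting_perm M S m < card S" using p by (auto simp: is_sorting_perm_def)
  assume "sorting_perm M S m < card S"
  then have "sorting_perm M S m \<in> sorting_perm M S ` S" using sorting_perm_image[OF S] by simp
  then show "m \<in> S" using p permutes_inj by (auto simp: is_sorting_perm_def dest: injD)
qed

lemma sorting_perm_lessThan: "S \<subseteq> {..<M} \<Longrightarrow> m < M \<Longrightarrow> sorting_perm M S m < M"
  using sorting_perm[of S M] permutes_in_image[of "sorting_perm M S" "{..<M}" m]
  by (simp add: is_sorting_perm_def)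

lemma inv_into_sorting_perm:
  assumes S: "S \<subseteq> {..<M}" and m: "m \<in> S"
  shows "inv_into S (sorting_perm M S) (sorting_perm M S m) = m"
  using sorting_perm[OF S] m
  by (intro inv_into_f_f) (auto simp: is_sorting_perm_def intro: strict_mono_on_imp_inj_on)

lemma transpose_perm_matrix_mult:
  fixes B :: "'a::comm_ring_1 mat"
  assumes B: "B \<in> carrier_mat M l" and p: "\<And>i. i < M \<Longrightarrow> p i < M"
  shows "transpose_mat (perm_matrix M p) * B = mat M l (\<lambda>(i, j). B $$ (p i, j))"
proof (rule eq_matI)
  fix i j assume "i < dim_row (mat M l (\<lambda>(i, j). B $$ (p i, j)))" "j < dim_col (mat M l (\<lambda>(i, j). B $$ (p i, j)))"
  then have ij: "i < M" "j < l" by auto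
  have "(transpose_mat (perm_matrix M p) * B) $$ (i, j) = (\<Sum>k<M. (if k = p i then 1 else 0) * B $$ (k, j))"
    using ij B by (simp add: perm_matrix_def scalar_prod_def lessThan_atLeast0)
  also have "\<dots> = (\<Sum>k<M. if k = p i then B $$ (k, j) else 0)" by (intro sum.cong) auto
  also have "\<dots> = B $$ (p i, j)" using p[OF ij(1)] by simp
  finally show "(transpose_mat (perm_matrix M p) * B) $$ (i, j) = mat M l (\<lambda>(i, j). B $$ (p i, j)) $$ (i, j)"
    using ij by simp
qed (use B in \<open>auto simp: perm_matrix_def\<close>)

lemma mult_perm_matrix:
  fixes B :: "'a::comm_ring_1 mat"
  assumes B: "B \<in> carrier_mat l M" and q: "\<And>i. i < M \<Longrightarrow> q i < M"
  shows "B * perm_matrix M q = mat l M (\<lambda>(i, j). B $$ (i, q j))"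
proof (rule eq_matI)
  fix i j assume "i < dim_row (mat l M (\<lambda>(i, j). B $$ (i, q j)))" "j < dim_col (mat l M (\<lambda>(i, j). B $$ (i, q j)))"
  then have ij: "i < l" "j < M" by auto
  have "(B * perm_matrix M q) $$ (i, j) = (\<Sum>k<M. B $$ (i, k) * (if k = q j then 1 else 0))"
    using ij B by (simp add: perm_matrix_def scalar_prod_def lessThan_atLeast0)
  also have "\<dots> = (\<Sum>k<M. if k = q j then B $$ (i, k) else 0)" by (intro sum.cong) auto
  also have "\<dots> = B $$ (i, q j)" using q[OF ij(2)] by simp
  finally show "(B * perm_matrix M q) $$ (i, j) = mat l M (\<lambda>(i, j). B $$ (i, q j)) $$ (i, j)"
    using ij by simp
qed (use B in \<open>auto simp: perm_matrix_def\<close>)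

lemma transpose_perm_matrix_mult_vec:
  fixes w :: "'a::comm_ring_1 vec"
  assumes w: "w \<in> carrier_vec M" and p: "\<And>i. i < M \<Longrightarrow> p i < M"
  shows "transpose_mat (perm_matrix M p) *\<^sub>v w = vec M (\<lambda>i. w $ p i)"
proof (rule eq_vecI)
  fix i assume "i < dim_vec (vec M (\<lambda>i. w $ p i))"
  then have i: "i < M" by simp
  have "(transpose_mat (perm_matrix M p) *\<^sub>v w) $ i = (\<Sum>k<M. (if k = p i then 1 else 0) * w $ k)"
    using i w by (simp add: perm_matrix_def scalar_prod_def lessThan_atLeast0)
  also have "\<dots> = (\<Sum>k<M. if k = p i then w $ k else 0)" by (intro sum.cong) auto
  also have "\<dots> = w $ p i" using p[OF i] by simp
  finally show "(transpose_mat (perm_matrix M p) *\<^sub>v w) $ i = vec M (\<lambda>i. w $ p i) $ i"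
    using i by simp
qed (simp add: perm_matrix_def)

section \<open>Block-diagonal unitary matrices\<close>

text \<open>
  Used for the indices of the largest value of a nonincreasing sequence, which form its first block.
\<close>

lemma initial_segment_eq_lessThan:
  fixes S :: "nat set"
  assumes "finite S" and down: "\<And>m l. m \<in> S \<Longrightarrow> l < m \<Longrightarrow> l \<in> S"
  shows "S = {..<card S}"
proof -
  define n where "n = (LEAST n. n \<notin> S)"
  have "n \<notin> S" unfolding n_def using assms(1) by (metis LeastI_ex ex_new_if_finite infinite_UNIV_nat)
  moreover have "m \<in> S" if "m < n" for m using not_less_Least[of m "\<lambda>n. n \<notin> S"] that by (auto simp: n_def)
  ultimately have "S = {..<n}" using down by (auto simp: not_less) (metis linorder_neqE_nat)
  then show ?thesis by (metis card_lessThan)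
qed

text \<open>
  Lists of blocks are replaced by a condition on entries, which is easier to use and to verify. The
  list of values is peeled off from the largest one, whose indices are \<open>0, \<dots>, c - 1\<close>; the rest is the same statement for
  \<open>a\<close> shifted by \<open>c\<close>.
\<close>

lemma diag_block_mat_iff:
  fixes V :: "'a::zero mat"
  assumes "sorted_wrt (>) xs" and "antimono_on {..<M} a" and "a ` {..<M} = set xs"
  shows "(\<exists>Bs. list_all2 (\<lambda>B x. B \<in> carrier_mat (multiplicity_in M a x) (multiplicity_in M a x)) Bs xs
      \<and> V = diag_block_mat Bs) \<longleftrightarrow>
    V \<in> carrier_mat M M \<and> (\<forall>i<M. \<forall>j<M. a i \<noteq> a j \<longrightarrow> V $$ (i, j) = 0)"
  using assms
proof (induction xs arbitrary: M a V)
  case Nil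
  from Nil.prems(3) have "M = 0" by (cases M) auto
  then show ?case by auto
next
  case (Cons x xs)
  define c where "c = multiplicity_in M a x"
  define M' where "M' = M - c"
  define a' where "a' m = a (c + m)" for m
  note anti = monotone_onD[OF Cons.prems(2)]
  have less: "y < x" if "y \<in> set xs" for y using Cons.prems(1) that by auto
  have "{m. m < M \<and> a m = x} = {..<card {m. m < M \<and> a m = x}}"
  proof (rule initial_segment_eq_lessThan)
    fix m l assume m: "m \<in> {m. m < M \<and> a m = x}" and l: "l < m"
    then have "x \<le> a l" using anti[of l m] by auto
    moreover have "a l \<in> set (x # xs)" using Cons.prems(3) m l by auto
    ultimately show "l \<in> {m. m < M \<and> a m = x}" using less[of "a l"] m l by auto
  qed simp
  then have block: "m < M \<and> a m = x \<longleftrightarrow> m < c" for m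
    unfolding c_def multiplicity_in_def by auto
  have "c \<le> M" using block[of M] by auto
  then have M: "M = c + M'" by (simp add: M'_def)
  have tail: "a' ` {..<M'} = set xs"
  proof
    show "a' ` {..<M'} \<subseteq> set xs"
    proof
      fix y assume "y \<in> a' ` {..<M'}"
      then obtain m where m: "m < M'" "y = a (c + m)" by (auto simp: a'_def)
      then have "y \<in> set (x # xs)" using Cons.prems(3) M by auto
      moreover have "y \<noteq> x" using block[of "c + m"] m M by auto
      ultimately show "y \<in> set xs" by auto
    qed
    show "set xs \<subseteq> a' ` {..<M'}"
    proof
      fix y assume y: "y \<in> set xs"
      then obtain m where m: "m < M" "y = a m" using Cons.prems(3) by force
      then have "c \<le> m" using block[of m] less[OF y] by force
      then show "y \<in> a' ` {..<M'}" using m M by (intro image_eqI[of _ _ "m - c"]) (auto simp: a'_def)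
    qed
  qed
  have mult: "multiplicity_in M' a' y = multiplicity_in M a y" if y: "y \<in> set xs" for y
  proof -
    have "{m. m < M \<and> a m = y} = (+) c ` {m. m < M' \<and> a' m = y}"
    proof (intro Set.set_eqI iffI)
      fix m assume m: "m \<in> {m. m < M \<and> a m = y}"
      then have "c \<le> m" using block[of m] less[OF y] by force
      then show "m \<in> (+) c ` {m. m < M' \<and> a' m = y}"
        using m M by (intro image_eqI[of _ _ "m - c"]) (auto simp: a'_def)
    qed (auto simp: a'_def M)
    then show ?thesis by (simp add: multiplicity_in_def card_image)
  qed
  have anti': "antimono_on {..<M'} a'"
    using anti by (auto simp: a'_def M intro!: monotone_onI)
  have IH: "(\<exists>Bs. list_all2 (\<lambda>B x. B \<in> carrier_mat (multiplicity_in M a x) (multiplicity_in M a x)) Bs xs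
      \<and> D = diag_block_mat Bs) \<longleftrightarrow>
    D \<in> carrier_mat M' M' \<and> (\<forall>i<M'. \<forall>j<M'. a' i \<noteq> a' j \<longrightarrow> D $$ (i, j) = 0)" for D :: "'a mat"
  proof -
    have "list_all2 (\<lambda>B x. B \<in> carrier_mat (multiplicity_in M a x) (multiplicity_in M a x)) Bs xs \<longleftrightarrow>
      list_all2 (\<lambda>B x. B \<in> carrier_mat (multiplicity_in M' a' x) (multiplicity_in M' a' x)) Bs xs"
      for Bs :: "'a mat list"
      using mult by (intro list.rel_cong) auto
    then show ?thesis using Cons.IH[OF _ anti' tail, of D] Cons.prems(1) by simp
  qed
  show ?case
  proof
    assume "\<exists>Bs. list_all2 (\<lambda>B x. B \<in> carrier_mat (multiplicity_in M a x) (multiplicity_in M a x)) Bs (x # xs)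
      \<and> V = diag_block_mat Bs"
    then obtain B Bs where B: "B \<in> carrier_mat c c"
      and Bs: "list_all2 (\<lambda>B x. B \<in> carrier_mat (multiplicity_in M a x) (multiplicity_in M a x)) Bs xs"
      and V: "V = diag_block_mat (B # Bs)"
      by (auto simp: list_all2_Cons2 c_def)
    define D where "D = diag_block_mat Bs"
    have D: "D \<in> carrier_mat M' M'" "\<And>i j. i < M' \<Longrightarrow> j < M' \<Longrightarrow> a' i \<noteq> a' j \<Longrightarrow> D $$ (i, j) = 0"
      using IH[of D] Bs by (auto simp: D_def)
    have V: "V = four_block_mat B (0\<^sub>m c M') (0\<^sub>m M' c) D"
      using B D by (simp add: V D_def[symmetric])
    have "V $$ (i, j) = 0" if ij: "i < M" "j < M" "a i \<noteq> a j" for i j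
    proof -
      consider "i < c" "j < c" | "i < c" "c \<le> j" | "c \<le> i" "j < c" | "c \<le> i" "c \<le> j" by linarith
      then show ?thesis
      proof cases
        case 1
        then show ?thesis using block[of i] block[of j] ij by auto
      next
        case 4
        then have "D $$ (i - c, j - c) = 0" using ij M by (intro D(2)) (auto simp: a'_def)
        then show ?thesis using 4 ij M B D(1) by (simp add: V)
      qed (use ij M B D(1) in \<open>simp_all add: V\<close>)
    qed
    moreover have "V \<in> carrier_mat M M" using B D(1) by (auto simp: V M)
    ultimately show "V \<in> carrier_mat M M \<and> (\<forall>i<M. \<forall>j<M. a i \<noteq> a j \<longrightarrow> V $$ (i, j) = 0)" by blast
  next
    assume V: "V \<in> carrier_mat M M \<and> (\<forall>i<M. \<forall>j<M. a i \<noteq> a j \<longrightarrow> V $$ (i, j) = 0)"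
    define B where "B = mat c c (\<lambda>(i, j). V $$ (i, j))"
    define D where "D = mat M' M' (\<lambda>(i, j). V $$ (c + i, c + j))"
    have "D \<in> carrier_mat M' M'" by (simp add: D_def)
    moreover have "\<forall>i<M'. \<forall>j<M'. a' i \<noteq> a' j \<longrightarrow> D $$ (i, j) = 0"
      using V by (auto simp: D_def a'_def M)
    ultimately obtain Bs where
      Bs: "list_all2 (\<lambda>B x. B \<in> carrier_mat (multiplicity_in M a x) (multiplicity_in M a x)) Bs xs"
      "D = diag_block_mat Bs" using IH[of D] by blast
    have B: "B \<in> carrier_mat c c" by (simp add: B_def)
    have "V = four_block_mat B (0\<^sub>m c M') (0\<^sub>m M' c) D"
    proof (rule eq_matI)
      fix i j
      assume "i < dim_row (four_block_mat B (0\<^sub>m c M') (0\<^sub>m M' c) D)"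
        "j < dim_col (four_block_mat B (0\<^sub>m c M') (0\<^sub>m M' c) D)"
      then have ij: "i < M" "j < M" by (auto simp: B_def D_def M)
      have "V $$ (i, j) = 0" if "(i < c) \<noteq> (j < c)"
        using that block[of i] block[of j] ij V by auto
      then show "V $$ (i, j) = four_block_mat B (0\<^sub>m c M') (0\<^sub>m M' c) D $$ (i, j)"
        using ij M by (auto simp: B_def D_def)
    qed (use V in \<open>auto simp: B_def D_def M\<close>)
    then have "V = diag_block_mat (B # Bs)"
      by (simp add: Bs(2)[symmetric] Let_def) (simp add: B_def D_def)
    then show "\<exists>Bs. list_all2 (\<lambda>B x. B \<in> carrier_mat (multiplicity_in M a x) (multiplicity_in M a x)) Bs (x # xs)
      \<and> V = diag_block_mat Bs"
      using B Bs(1) by (intro exI[of _ "B # Bs"]) (auto simp: c_def)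
  qed
qed

lemma block_unitary_iff:
  assumes "antimono_on {..<M} a"
  shows "block_unitary M a V \<longleftrightarrow>
    unitary_mat M V \<and> (\<forall>i<M. \<forall>j<M. a i \<noteq> a j \<longrightarrow> V $$ (i, j) = 0)"
proof -
  have "sorted_wrt (>) (rev (sorted_list_of_set (a ` {..<M})))"
    using strict_sorted_list_of_set[of "a ` {..<M}"] by (simp add: sorted_wrt_rev)
  from diag_block_mat_iff[OF this assms, of V] show ?thesis
    unfolding block_unitary_def by (auto simp: unitary_mat_def)
qed

section \<open>One step of the algorithm\<close>

text \<open>
  The entries of \<open>\<Pi>\<^sub>I\<^sup>T [v; 0]\<close>.
\<close>

definition step_vec :: "nat \<Rightarrow> (nat \<Rightarrow> real) \<Rightarrow> (nat \<Rightarrow> real) \<Rightarrow> nat \<Rightarrow> real"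
  where "step_vec M a b i =
    (if i \<in> excess_indices M a b then v_entry (excess_indices M a b) (excess_indices M b a) a b i else 0)"

text \<open>
  The entries of \<open>\<Pi>\<^sub>I\<^sup>T [W, 0; 0, 1] \<Pi>\<^sub>J\<close>. For \<open>i \<in> I\<close> and \<open>j \<notin> J\<close> the last case gives \<open>0\<close>, because the
  permutation of \<open>I\<close> sends \<open>i\<close> below \<open>card I = card J\<close> and that of \<open>J\<close> does not send \<open>j\<close> there.
\<close>

definition step_mat :: "nat \<Rightarrow> (nat \<Rightarrow> real) \<Rightarrow> (nat \<Rightarrow> real) \<Rightarrow> nat \<Rightarrow> nat \<Rightarrow> real"
  where "step_mat M a b i j =
    (let I = excess_indices M a b; J = excess_indices M b a in
      if j \<in> J then
        if i \<in> I then v_entry I J a b i * w_entry I J a b j / (b j - a i) else 0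
      else if sorting_perm M I i = sorting_perm M J j then 1 else 0)"

lemma next_vector_eq:
  fixes U V :: "'a::real_or_complex mat"
  assumes U: "U \<in> carrier_mat M M" and V: "V \<in> carrier_mat M M"
  shows "next_vector M a b U V = (U * V) *\<^sub>v vec M (\<lambda>i. of_real (step_vec M a b i))"
proof -
  let ?I = "excess_indices M a b" and ?J = "excess_indices M b a"
  let ?p = "sorting_perm M ?I" and ?R = "card ?I"
  let ?w = "map_vec of_real (v_vec M ?I ?J a b) @\<^sub>v 0\<^sub>v (M - ?R) :: 'a vec"
  note I = excess_indices_subset[of M a b]
  have R: "?R \<le> M" using card_mono[OF _ I] by simp
  have w: "?w \<in> carrier_vec M" using R by (intro carrier_vecI) (simp add: v_vec_def)
  have P: "transpose_mat (perm_matrix M ?p) \<in> carrier_mat M M" by (simp add: perm_matrix_def)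
  have "transpose_mat (perm_matrix M ?p) *\<^sub>v ?w = vec M (\<lambda>i. ?w $ ?p i)"
    using sorting_perm_lessThan[OF I] by (intro transpose_perm_matrix_mult_vec w)
  also have "\<dots> = vec M (\<lambda>i. of_real (step_vec M a b i))"
  proof (rule eq_vecI)
    fix i assume "i < dim_vec (vec M (\<lambda>i. of_real (step_vec M a b i) :: 'a))"
    then have i: "i < M" by simp
    then show "vec M (\<lambda>i. ?w $ ?p i) $ i = vec M (\<lambda>i. of_real (step_vec M a b i)) $ i"
      using sorting_perm_less_iff[OF I, of i] sorting_perm_lessThan[OF I i] R
        inv_into_sorting_perm[OF I, of i]
      by (auto simp: step_vec_def v_vec_def)
  qed simp
  finally show ?thesis
    unfolding next_vector_def Let_def
    using assoc_mult_mat_vec[OF mult_carrier_mat[OF U V] P w] by simp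
qed

lemma next_basis_eq:
  fixes U V :: "'a::real_or_complex mat"
  assumes U: "U \<in> carrier_mat M M" and V: "V \<in> carrier_mat M M"
    and cards: "card (excess_indices M a b) = card (excess_indices M b a)"
  shows "next_basis M a b U V = (U * V) * mat M M (\<lambda>(i, j). of_real (step_mat M a b i j))"
proof -
  let ?I = "excess_indices M a b" and ?J = "excess_indices M b a"
  let ?p = "sorting_perm M ?I" and ?q = "sorting_perm M ?J" and ?R = "card ?I"
  let ?W = "four_block_mat (map_mat of_real (W_mat M ?I ?J a b)) (0\<^sub>m ?R (M - ?R))
      (0\<^sub>m (M - ?R) ?R) (1\<^sub>m (M - ?R)) :: 'a mat"
  note I = excess_indices_subset[of M a b] and J = excess_indices_subset[of M b a]
  have R: "?R \<le> M" using card_mono[OF _ I] by simp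
  have W: "?W \<in> carrier_mat M M"
    using R by (intro carrier_matI) (simp_all add: W_mat_def)
  have P: "transpose_mat (perm_matrix M ?p) \<in> carrier_mat M M"
    and Q: "perm_matrix M ?q \<in> carrier_mat M M" by (simp_all add: perm_matrix_def)
  have "transpose_mat (perm_matrix M ?p) * ?W * perm_matrix M ?q =
      mat M M (\<lambda>(i, j). ?W $$ (?p i, ?q j))"
  proof -
    have "transpose_mat (perm_matrix M ?p) * ?W = mat M M (\<lambda>(i, j). ?W $$ (?p i, j))"
      using sorting_perm_lessThan[OF I] by (intro transpose_perm_matrix_mult W)
    moreover have "mat M M (\<lambda>(i, j). ?W $$ (?p i, j)) * perm_matrix M ?q =
        mat M M (\<lambda>(i, j). mat M M (\<lambda>(i, j). ?W $$ (?p i, j)) $$ (i, ?q j))"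
      using sorting_perm_lessThan[OF J] by (intro mult_perm_matrix) auto
    moreover have "\<dots> = mat M M (\<lambda>(i, j). ?W $$ (?p i, ?q j))"
      using sorting_perm_lessThan[OF J] by (intro eq_matI) auto
    ultimately show ?thesis by simp
  qed
  also have "\<dots> = mat M M (\<lambda>(i, j). of_real (step_mat M a b i j))"
  proof (rule eq_matI)
    fix i j
    assume "i < dim_row (mat M M (\<lambda>(i, j). of_real (step_mat M a b i j) :: 'a))"
      "j < dim_col (mat M M (\<lambda>(i, j). of_real (step_mat M a b i j) :: 'a))"
    then have ij: "i < M" "j < M" by auto
    show "mat M M (\<lambda>(i, j). ?W $$ (?p i, ?q j)) $$ (i, j) =
        mat M M (\<lambda>(i, j). of_real (step_mat M a b i j)) $$ (i, j)"
      using ij sorting_perm_less_iff[OF I, of i] sorting_perm_lessThan[OF I ij(1)] R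
        inv_into_sorting_perm[OF I, of i] sorting_perm_less_iff[OF J, of j]
        sorting_perm_lessThan[OF J ij(2)] inv_into_sorting_perm[OF J, of j] cards
      by (auto simp: step_mat_def Let_def W_mat_def v_vec_def w_vec_def)
  qed simp_all
  finally have "transpose_mat (perm_matrix M ?p) * ?W * perm_matrix M ?q =
      mat M M (\<lambda>(i, j). of_real (step_mat M a b i j))" .
  then show ?thesis
    unfolding next_basis_def Let_def
    using assoc_mult_mat[OF mult_carrier_mat[OF U V] P W]
      assoc_mult_mat[OF mult_carrier_mat[OF U V] mult_carrier_mat[OF P W] Q]
    by simp
qed

text \<open>
  Columns in \<open>J\<close> are columns of the Cauchy matrix \<open>W\<close>. A column \<open>j\<close> outside \<open>J\<close> is a standard basis vector
  with index \<open>\<sigma> j\<close> outside \<open>I\<close>; it is orthogonal to \<open>step_vec\<close>, so it remains an eigenvector with eigenvalue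
  \<open>a (\<sigma> j)\<close>, which equals \<open>b j\<close> since both complements list the same values in the same order.
\<close>

lemma
  assumes a: "antimono_on {..<M} a" and b: "antimono_on {..<M} b" and ab: "interlaces M a b"
  shows step_mat_orthonormal: "\<And>j l. j < M \<Longrightarrow> l < M \<Longrightarrow>
      (\<Sum>i<M. step_mat M a b i j * step_mat M a b i l) = (if j = l then 1 else 0)"
    and step_mat_eigen: "\<And>i j. i < M \<Longrightarrow> j < M \<Longrightarrow>
      a i * step_mat M a b i j + step_vec M a b i * (\<Sum>k<M. step_vec M a b k * step_mat M a b k j) =
      step_mat M a b i j * b j"
proof -
  let ?I = "excess_indices M a b" and ?J = "excess_indices M b a"
  let ?v = "v_entry ?I ?J a b" and ?w = "w_entry ?I ?J a b"
  let ?p = "sorting_perm M ?I" and ?q = "sorting_perm M ?J"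
  let ?x = "step_mat M a b" and ?g = "step_vec M a b"
  interpret interlacing_nodes ?I ?J a b
    by (rule interlacing_nodes_excess_indices[OF a b ab])
  note I = excess_indices_subset[of M a b] and J = excess_indices_subset[of M b a]
  have p: "?p permutes {..<M}" "strict_mono_on ({..<M} - ?I) ?p"
    and q: "?q permutes {..<M}" "strict_mono_on ({..<M} - ?J) ?q"
    using sorting_perm[OF I] sorting_perm[OF J] by (auto simp: is_sorting_perm_def)
  define \<sigma> where "\<sigma> = inv_into UNIV ?p \<circ> ?q"
  have \<sigma>: "\<sigma> permutes {..<M}"
    unfolding \<sigma>_def by (intro permutes_compose q(1) permutes_inv p(1))
  have p_\<sigma>: "?p (\<sigma> j) = ?q j" for j
    using p(1) by (simp add: \<sigma>_def permutes_inverses)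
  have p_eq_iff: "?p i = ?q j \<longleftrightarrow> i = \<sigma> j" for i j
    using permutes_inj[OF p(1)] p_\<sigma>[of j] by (metis injD)
  have \<sigma>_iff: "\<sigma> j \<in> ?I \<longleftrightarrow> j \<in> ?J" for j
    using sorting_perm_less_iff[OF I, of "\<sigma> j"] sorting_perm_less_iff[OF J, of j] card_eq
    by (simp add: p_\<sigma>)
  have \<sigma>_less: "\<sigma> j < M" if "j < M" for j
    using permutes_in_image[OF \<sigma>, of j] that by simp
  have x_out: "?x i j = (if i = \<sigma> j then 1 else 0)" if "j \<notin> ?J" for i j
    using that by (simp add: step_mat_def Let_def p_eq_iff)
  have x_in: "?x i j = (if i \<in> ?I then ?v i * ?w j / (b j - a i) else 0)" if "j \<in> ?J" for i j
    using that by (simp add: step_mat_def Let_def)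
  have sum_I: "(\<Sum>i<M. h i) = (\<Sum>i\<in>?I. h i)" if "\<And>i. i \<notin> ?I \<Longrightarrow> h i = 0" for h :: "nat \<Rightarrow> real"
    using I that by (intro sum.mono_neutral_right) auto
  have matched: "a (\<sigma> j) = b j" if j: "j < M" "j \<notin> ?J" for j
  proof -
    let ?S = "{..<M} - ?J"
    have inj: "inj_on \<sigma> ?S" using permutes_inj[OF \<sigma>] by (rule inj_on_subset) simp
    have "\<sigma> ` ?S = \<sigma> ` {..<M} - \<sigma> ` ?J"
      using permutes_inj[OF \<sigma>] by (rule image_set_diff)
    moreover have "\<sigma> ` ?J = ?I"
      using inj_on_subset[OF permutes_inj[OF \<sigma>], of ?J] \<sigma>_iff card_eq
      by (intro card_subset_eq) (auto simp: card_image)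
    ultimately have img: "\<sigma> ` ?S = {..<M} - ?I" using permutes_image[OF \<sigma>] by simp
    have anti_a: "antimono_on ?S (a \<circ> \<sigma>)"
    proof (rule monotone_onI)
      fix k l assume kl: "k \<in> ?S" "l \<in> ?S" "k \<le> l"
      have "\<sigma> k \<le> \<sigma> l"
      proof (rule ccontr)
        assume "\<not> \<sigma> k \<le> \<sigma> l"
        moreover have "\<sigma> k \<in> {..<M} - ?I" "\<sigma> l \<in> {..<M} - ?I"
          using img kl by blast+
        ultimately have "?p (\<sigma> l) < ?p (\<sigma> k)" using strict_mono_onD[OF p(2)] by simp
        then have less: "?q l < ?q k" by (simp add: p_\<sigma>)
        then have "k < l" using kl(3) by (cases "k = l") auto
        then show False using strict_mono_onD[OF q(2) kl(1,2)] less by simp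
      qed
      then show "(a \<circ> \<sigma>) l \<le> (a \<circ> \<sigma>) k"
        using monotone_onD[OF a, of "\<sigma> k" "\<sigma> l"] \<sigma>_less kl by simp
    qed
    have anti_b: "antimono_on ?S b" using b by (rule monotone_on_subset) auto
    have values_eq: "image_mset (a \<circ> \<sigma>) (mset_set ?S) = image_mset b (mset_set ?S)"
    proof -
      have "image_mset (a \<circ> \<sigma>) (mset_set ?S) = image_mset a (mset_set ({..<M} - ?I))"
        using image_mset_mset_set[OF inj] by (simp add: img flip: multiset.map_comp)
      also have "\<dots> = values_mset M a \<inter># values_mset M b"
        using interlaces_imp_multiplicity(1)[OF ab] by (intro image_mset_excess_indices_compl a)
      also have "\<dots> = values_mset M b \<inter># values_mset M a"
        by (rule multiset_eqI) (simp add: min.commute)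
      also have "\<dots> = image_mset b (mset_set ?S)"
        using interlaces_imp_multiplicity(2)[OF ab]
        by (intro image_mset_excess_indices_compl[symmetric] b)
      finally show ?thesis .
    qed
    have "(a \<circ> \<sigma>) j = b j"
      by (rule antimono_on_eq_if_image_mset_eq[OF _ anti_a anti_b values_eq]) (use j in simp_all)
    then show ?thesis by simp
  qed
  show "(\<Sum>i<M. ?x i j * ?x i l) = (if j = l then 1 else 0)" if jl: "j < M" "l < M" for j l
  proof -
    have in_out: "(\<Sum>i<M. ?x i j * ?x i l) = 0" if "j \<in> ?J" "l \<notin> ?J" for j l
      using that \<sigma>_iff[of l] by (intro sum.neutral) (auto simp: x_in x_out)
    consider "j \<in> ?J" "l \<in> ?J" | "j \<in> ?J" "l \<notin> ?J" | "j \<notin> ?J" "l \<in> ?J" | "j \<notin> ?J" "l \<notin> ?J" by blast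
    then show ?thesis
    proof cases
      case 1
      then have "(\<Sum>i<M. ?x i j * ?x i l) = (\<Sum>i\<in>?I. ?x i j * ?x i l)"
        by (intro sum_I) (simp add: x_in)
      also have "\<dots> = (\<Sum>i\<in>?I. (?v i * ?w j / (b j - a i)) * (?v i * ?w l / (b l - a i)))"
        using 1 by (intro sum.cong) (simp_all add: x_in)
      finally show ?thesis using cauchy_orthonormal[OF 1] by simp
    next
      case 2
      then show ?thesis using in_out by auto
    next
      case 3
      then show ?thesis using in_out[of l j] by (auto simp: mult.commute)
    next
      case 4
      have "\<sigma> j = \<sigma> l \<longleftrightarrow> j = l" using permutes_inj[OF \<sigma>] by (auto dest: injD)
      moreover have "(\<Sum>i<M. ?x i j * ?x i l) = (\<Sum>i<M. if i = \<sigma> j then if \<sigma> j = \<sigma> l then 1 else 0 else 0)"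
        using 4 by (intro sum.cong) (auto simp: x_out)
      ultimately show ?thesis using \<sigma>_less[OF jl(1)] by simp
    qed
  qed
  show "a i * ?x i j + ?g i * (\<Sum>k<M. ?g k * ?x k j) = ?x i j * b j" if ij: "i < M" "j < M" for i j
  proof (cases "j \<in> ?J")
    case True
    have "(\<Sum>k<M. ?g k * ?x k j) = (\<Sum>k\<in>?I. ?v k * (?v k * ?w j / (b j - a k)))"
      using True by (subst sum_I) (auto simp: step_vec_def x_in intro!: sum.cong)
    then have dot: "(\<Sum>k<M. ?g k * ?x k j) = ?w j" using cauchy_column_dot_v[OF True] by simp
    show ?thesis
    proof (cases "i \<in> ?I")
      case i: True
      then have "b j - a i \<noteq> 0" using disjoint_values[OF i True] by simp
      then show ?thesis
        unfolding dot using True i by (simp add: x_in step_vec_def divide_simps) (simp add: algebra_simps)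
    qed (use True in \<open>simp add: x_in step_vec_def\<close>)
  next
    case False
    have "(\<Sum>k<M. ?g k * ?x k j) = 0"
      using False \<sigma>_iff[of j] by (intro sum.neutral) (auto simp: x_out step_vec_def)
    then show ?thesis using False matched[OF ij(2)] by (simp add: x_out)
  qed
qed

text \<open>
  The step from one frame operator to the next. With \<open>Q = U V\<close>, \<open>X\<close> the
  matrix \<open>step_mat\<close> and \<open>g\<close> the vector \<open>step_vec\<close>, \<open>A Q = Q D\<^sub>a\<close> because \<open>V\<close> commutes with \<open>D\<^sub>a\<close>, and \<open>(D\<^sub>a + g g\<^sup>*) X = X D\<^sub>b\<close>.
\<close>

lemma next_step:
  fixes A U V :: "'a::real_or_complex mat"
  assumes a: "antimono_on {..<M} a" and b: "antimono_on {..<M} b" and ab: "interlaces M a b"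
    and A: "A \<in> carrier_mat M M" and U: "unitary_mat M U" and V: "block_unitary M a V"
    and diag: "A * U = U * mat_diag M (\<lambda>m. of_real (a m))"
  shows "next_vector M a b U V \<in> carrier_vec M"
    and "unitary_mat M (next_basis M a b U V)"
    and "(A + outer_product (next_vector M a b U V)) * next_basis M a b U V =
      next_basis M a b U V * mat_diag M (\<lambda>m. of_real (b m))"
proof -
  define X :: "'a mat" where "X = mat M M (\<lambda>(i, j). of_real (step_mat M a b i j))"
  define g :: "'a vec" where "g = vec M (\<lambda>i. of_real (step_vec M a b i))"
  define Q where "Q = U * V"
  let ?Da = "mat_diag M (\<lambda>m. of_real (a m)) :: 'a mat"
    and ?Db = "mat_diag M (\<lambda>m. of_real (b m)) :: 'a mat"
  interpret interlacing_nodes "excess_indices M a b" "excess_indices M b a" a b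
    by (rule interlacing_nodes_excess_indices[OF a b ab])
  have V': "unitary_mat M V" "\<And>i j. i < M \<Longrightarrow> j < M \<Longrightarrow> a i \<noteq> a j \<Longrightarrow> V $$ (i, j) = 0"
    using V by (auto simp: block_unitary_iff[OF a])
  have c: "U \<in> carrier_mat M M" "V \<in> carrier_mat M M" using U V' by (auto simp: unitary_mat_def)
  have X: "X \<in> carrier_mat M M" and g: "g \<in> carrier_vec M" by (simp_all add: X_def g_def)
  have Q: "unitary_mat M Q" unfolding Q_def by (rule unitary_mat_mult[OF U V'(1)])
  then have Qc: "Q \<in> carrier_mat M M" "mat_adjoint Q \<in> carrier_mat M M" "mat_adjoint Q * Q = 1\<^sub>m M"
    by (auto simp: unitary_mat_def)
  have vector: "next_vector M a b U V = Q *\<^sub>v g"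
    unfolding Q_def g_def by (rule next_vector_eq[OF c])
  have basis: "next_basis M a b U V = Q * X"
    unfolding Q_def X_def by (rule next_basis_eq[OF c card_eq])
  show "next_vector M a b U V \<in> carrier_vec M" using Qc g by (simp add: vector)
  have "unitary_mat M X"
    unfolding unitary_mat_iff_columns[OF X]
  proof (intro allI impI)
    fix i j assume ij: "i < M" "j < M"
    have "(\<Sum>k<M. conjugate (X $$ (k, i)) * X $$ (k, j)) =
        of_real (\<Sum>k<M. step_mat M a b k i * step_mat M a b k j)"
      using ij by (simp add: X_def)
    then show "(\<Sum>k<M. conjugate (X $$ (k, i)) * X $$ (k, j)) = (if i = j then 1 else 0)"
      using step_mat_orthonormal[OF a b ab ij] by simp
  qed
  then show "unitary_mat M (next_basis M a b U V)"
    unfolding basis by (rule unitary_mat_mult[OF Q])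
  have commute: "V * ?Da = ?Da * V"
    unfolding mat_diag_mult_left[OF c(2)] mat_diag_mult_right[OF c(2)]
    using V'(2) by (intro eq_matI) auto
  have AQ: "A * Q = Q * ?Da"
  proof -
    have "A * Q = (A * U) * V" unfolding Q_def using A c by simp
    also have "\<dots> = U * (?Da * V)"
      unfolding diag using assoc_mult_mat[OF c(1) mat_diag_dim c(2)] by simp
    also have "\<dots> = Q * ?Da"
      unfolding commute[symmetric] Q_def using assoc_mult_mat[OF c mat_diag_dim] by simp
    finally show ?thesis .
  qed
  have secular: "(?Da + outer_product g) * X = X * ?Db"
  proof (rule eq_matI)
    fix i j assume "i < dim_row (X * ?Db)" "j < dim_col (X * ?Db)"
    then have ij: "i < M" "j < M" using X by (auto simp: mat_diag_def)
    have "(outer_product g * X) $$ (i, j) =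
        of_real (step_vec M a b i * (\<Sum>k<M. step_vec M a b k * step_mat M a b k j))"
      using ij by (simp add: outer_product_def g_def X_def scalar_prod_def lessThan_atLeast0
          sum_distrib_left mult.assoc)
    moreover have "(?Da * X) $$ (i, j) = of_real (a i * step_mat M a b i j)"
      unfolding mat_diag_mult_left[OF X] using ij by (simp add: X_def)
    moreover have "(X * ?Db) $$ (i, j) = of_real (step_mat M a b i j * b j)"
      unfolding mat_diag_mult_right[OF X] using ij by (simp add: X_def)
    moreover have "(?Da + outer_product g) * X = ?Da * X + outer_product g * X"
      using X g by (intro add_mult_distrib_mat[of _ M M]) simp_all
    moreover have "?Da * X \<in> carrier_mat M M" "outer_product g * X \<in> carrier_mat M M"
      using X g outer_product_carrier[OF g] mult_carrier_mat mat_diag_dim by blast+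
    ultimately show "((?Da + outer_product g) * X) $$ (i, j) = (X * ?Db) $$ (i, j)"
      using ij carrier_vecD[OF g] carrier_matD[OF X]
        arg_cong[OF step_mat_eigen[OF a b ab ij], of "of_real :: real \<Rightarrow> 'a"] by simp
  qed (use X g in \<open>simp_all add: mat_diag_def outer_product_def\<close>)
  have o: "outer_product g \<in> carrier_mat M M" using g by simp
  have "(A + outer_product (Q *\<^sub>v g)) * Q = A * Q + outer_product (Q *\<^sub>v g) * Q"
    using A Qc g by (intro add_mult_distrib_mat[of _ M M]) simp_all
  also have "outer_product (Q *\<^sub>v g) * Q = Q * outer_product g"
  proof -
    have "outer_product (Q *\<^sub>v g) * Q = Q * outer_product g * (mat_adjoint Q * Q)"
      unfolding outer_product_mult_mat_vec[OF Qc(1) g]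
      by (rule assoc_mult_mat[OF mult_carrier_mat[OF Qc(1) o] Qc(2,1)])
    then show ?thesis
      using right_mult_one_mat[OF mult_carrier_mat[OF Qc(1) o]] by (simp add: Qc(3))
  qed
  also have "A * Q + Q * outer_product g = Q * (?Da + outer_product g)"
    unfolding AQ by (rule mult_add_distrib_mat[OF Qc(1) mat_diag_dim o, symmetric])
  finally have "(A + outer_product (Q *\<^sub>v g)) * Q = Q * (?Da + outer_product g)" .
  then have "(A + outer_product (Q *\<^sub>v g)) * (Q * X) = Q * (?Da + outer_product g) * X"
    using assoc_mult_mat[OF _ Qc(1) X, of "A + outer_product (Q *\<^sub>v g)" M] A Qc g by simp
  also have "\<dots> = Q * ((?Da + outer_product g) * X)"
    using Qc o X by (intro assoc_mult_mat[of _ M M]) simp_all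
  also have "\<dots> = Q * X * ?Db"
    unfolding secular by (rule assoc_mult_mat[OF Qc(1) X mat_diag_dim, symmetric])
  finally show "(A + outer_product (next_vector M a b U V)) * next_basis M a b U V =
      next_basis M a b U V * ?Db"
    by (simp add: vector basis)
qed

section \<open>Diagonalized frame operators\<close>

text \<open>
  The invariant of the algorithm. Spectrum, eigenbasis and trace of \<open>A\<close> all follow from it, and it is
  the form in which one step is passed on to the next.
\<close>

definition diagonalizes :: "nat \<Rightarrow> 'a::real_or_complex mat \<Rightarrow> (nat \<Rightarrow> real) \<Rightarrow> 'a mat \<Rightarrow> bool"
  where "diagonalizes M A e U \<longleftrightarrow> A \<in> carrier_mat M M \<and> antimono_on {..<M} e \<and> unitary_mat M U \<and>
    A * U = U * mat_diag M (\<lambda>m. of_real (e m))"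

lemma diagonalizes_decomposition:
  assumes "diagonalizes M A e U"
  shows "A = U * mat_diag M (\<lambda>m. of_real (e m)) * mat_adjoint U"
proof -
  have c: "A \<in> carrier_mat M M" "U \<in> carrier_mat M M" "mat_adjoint U \<in> carrier_mat M M"
    and UU: "U * mat_adjoint U = 1\<^sub>m M"
    and AU: "A * U = U * mat_diag M (\<lambda>m. of_real (e m))"
    using assms by (auto simp: diagonalizes_def unitary_mat_def)
  have "A = A * (U * mat_adjoint U)" unfolding UU using c by simp
  also have "\<dots> = A * U * mat_adjoint U" by (rule assoc_mult_mat[OF c, symmetric])
  finally show ?thesis by (simp add: AU)
qed

lemma diagonalizes_imp_has_spectrum:
  assumes d: "diagonalizes M A e U"
  shows "has_spectrum M A e"
proof -
  let ?D = "mat_diag M (\<lambda>m. of_real (e m)) :: 'a mat"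
  have c: "A \<in> carrier_mat M M" "U \<in> carrier_mat M M" "mat_adjoint U \<in> carrier_mat M M"
    "U * mat_adjoint U = 1\<^sub>m M" "mat_adjoint U * U = 1\<^sub>m M"
    using d by (auto simp: diagonalizes_def unitary_mat_def)
  have "similar_mat A ?D"
    using c diagonalizes_decomposition[OF d] by (intro similar_matI[of _ _ U "mat_adjoint U" M]) auto
  then have "char_poly A = char_poly ?D" by (rule char_poly_similar)
  also have "\<dots> = (\<Prod>x\<leftarrow>diag_mat ?D. [:- x, 1:])"
    by (rule char_poly_upper_triangular[of _ M]) (auto simp: mat_diag_def upper_triangular_def)
  also have "diag_mat ?D = map (\<lambda>m. of_real (e m)) [0..<M]"
    by (auto simp: diag_mat_def mat_diag_def)
  also have "(\<Prod>x\<leftarrow>map (\<lambda>m. of_real (e m)) [0..<M]. [:- x, 1:]) = (\<Prod>m<M. [:- of_real (e m) :: 'a, 1:])"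
    by (simp add: comp_def lessThan_atLeast0 prod.distinct_set_conv_list[symmetric])
  finally show ?thesis using d by (simp add: has_spectrum_def diagonalizes_def)
qed

lemma scalar_prod_conjugate_col:
  fixes U :: "'a::conjugatable_field mat"
  assumes "U \<in> carrier_mat M M" "i < M" "j < M"
  shows "col U i \<bullet>c col U j = (\<Sum>k<M. conjugate (U $$ (k, j)) * U $$ (k, i))"
  using assms by (auto simp: scalar_prod_def lessThan_atLeast0 intro!: sum.cong mult.commute)

lemma diagonalizes_imp_orthonormal_eigenbasis:
  assumes d: "diagonalizes M A e U"
  shows "orthonormal_eigenbasis M A e U"
proof -
  have c: "A \<in> carrier_mat M M" "U \<in> carrier_mat M M" "unitary_mat M U"
    and AU: "A * U = U * mat_diag M (\<lambda>m. of_real (e m))"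
    using d by (auto simp: diagonalizes_def unitary_mat_def)
  have orth: "col U i \<bullet>c col U j = (if i = j then 1 else 0)" if "i < M" "j < M" for i j
    using c(3) that unfolding unitary_mat_iff_columns[OF c(2)]
    by (auto simp: scalar_prod_conjugate_col[OF c(2)])
  have "eigenvector A (col U m) (of_real (e m))" if m: "m < M" for m
  proof -
    have "col U m \<noteq> 0\<^sub>v M"
    proof
      assume "col U m = 0\<^sub>v M"
      then have "col U m \<bullet>c col U m = 0" by simp
      then show False using orth[OF m m] by simp
    qed
    moreover have "A *\<^sub>v col U m = of_real (e m) \<cdot>\<^sub>v col U m"
    proof -
      have "A *\<^sub>v col U m = col (A * U) m" by (rule col_mult2[OF c(1,2) m, symmetric])
      also have "\<dots> = of_real (e m) \<cdot>\<^sub>v col U m"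
        unfolding AU mat_diag_mult_right[OF c(2)] using m c by (intro eq_vecI) (auto simp: mult.commute)
      finally show ?thesis .
    qed
    ultimately show ?thesis using c by (auto simp: eigenvector_def)
  qed
  with c orth show ?thesis by (auto simp: orthonormal_eigenbasis_def)
qed

lemma diagonalizes_trace:
  fixes A :: "'a::real_or_complex mat"
  assumes d: "diagonalizes M A e U"
  shows "(\<Sum>i<M. A $$ (i, i)) = of_real (\<Sum>m<M. e m)"
proof -
  let ?D = "mat_diag M (\<lambda>m. of_real (e m)) :: 'a mat"
  have c: "U \<in> carrier_mat M M" "mat_adjoint U \<in> carrier_mat M M"
    and cols: "\<And>k. k < M \<Longrightarrow> (\<Sum>i<M. conjugate (U $$ (i, k)) * U $$ (i, k)) = 1"
    using d unitary_mat_iff_columns[of U M] by (auto simp: diagonalizes_def unitary_mat_def)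
  have "A $$ (i, i) = (\<Sum>k<M. of_real (e k) * (conjugate (U $$ (i, k)) * U $$ (i, k)))" if i: "i < M" for i
  proof -
    have "A $$ (i, i) = (U * ?D * mat_adjoint U) $$ (i, i)"
      using diagonalizes_decomposition[OF d] by simp
    also have "\<dots> = (\<Sum>k<M. of_real (e k) * (conjugate (U $$ (i, k)) * U $$ (i, k)))"
      unfolding mat_diag_mult_right[OF c(1)] using i c
      by (auto simp: mat_adjoint_eq[OF c(1)] scalar_prod_def lessThan_atLeast0 intro!: sum.cong)
    finally show ?thesis .
  qed
  then have "(\<Sum>i<M. A $$ (i, i)) = (\<Sum>i<M. \<Sum>k<M. of_real (e k) * (conjugate (U $$ (i, k)) * U $$ (i, k)))"
    by simp
  also have "\<dots> = (\<Sum>k<M. of_real (e k) * (\<Sum>i<M. conjugate (U $$ (i, k)) * U $$ (i, k)))"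
    unfolding sum_distrib_left by (rule sum.swap)
  finally show ?thesis by (simp add: cols)
qed

lemma scalar_prod_conjugate_eq_sum:
  "g \<in> carrier_vec M \<Longrightarrow> g \<bullet>c g = (\<Sum>i<M. g $ i * conjugate (g $ i))"
  by (auto simp: scalar_prod_def lessThan_atLeast0 intro!: sum.cong)

text \<open>
  The trace is the sum of the eigenvalues and also grows by the squared length of the added vector.
  This links the sums of eigensteps to the lengths \<open>mu\<close>.
\<close>

lemma diagonalizes_rank_one_update_trace:
  fixes A :: "'a::real_or_complex mat"
  assumes "diagonalizes M A a U" and "diagonalizes M (A + outer_product g) b U'"
    and g: "g \<in> carrier_vec M"
  shows "g \<bullet>c g = of_real ((\<Sum>m<M. b m) - (\<Sum>m<M. a m))"
proof -
  have "(\<Sum>i<M. (A + outer_product g) $$ (i, i)) = (\<Sum>i<M. A $$ (i, i)) + (g \<bullet>c g)"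
    unfolding scalar_prod_conjugate_eq_sum[OF g] sum.distrib[symmetric]
    using g by (intro sum.cong) (auto simp: outer_product_def)
  then show ?thesis
    unfolding diagonalizes_trace[OF assms(1)] diagonalizes_trace[OF assms(2)]
    by (simp add: algebra_simps)
qed

lemma diagonalizes_next_step:
  fixes A U V :: "'a::real_or_complex mat"
  assumes "diagonalizes M A a U" and b: "antimono_on {..<M} b" and ab: "interlaces M a b"
    and V: "block_unitary M a V"
  shows "next_vector M a b U V \<in> carrier_vec M"
    and "diagonalizes M (A + outer_product (next_vector M a b U V)) b (next_basis M a b U V)"
proof -
  have d: "A \<in> carrier_mat M M" "antimono_on {..<M} a" "unitary_mat M U"
    "A * U = U * mat_diag M (\<lambda>m. of_real (a m))"
    using assms(1) by (auto simp: diagonalizes_def)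
  note step = next_step[OF d(2) b ab d(1) d(3) V d(4)]
  show "next_vector M a b U V \<in> carrier_vec M" by (rule step(1))
  show "diagonalizes M (A + outer_product (next_vector M a b U V)) b (next_basis M a b U V)"
    unfolding diagonalizes_def using step b d(1) by simp
qed

lemma has_spectrum_unique:
  fixes A :: "'a::real_or_complex mat"
  assumes e: "has_spectrum M A e" and l: "has_spectrum M A l" and m: "m < M"
  shows "e m = l m"
proof -
  have roots: "proots (char_poly A) = image_mset of_real (image_mset h (mset_set {..<M}))"
    if "has_spectrum M A h" for h
  proof -
    have "proots (char_poly A) = (\<Sum>m<M. proots [:- of_real (h m) :: 'a, 1:])"
      using that by (simp add: has_spectrum_def proots_prod)
    also have "\<dots> = (\<Sum>m<M. {#of_real (h m)#})"
      by (intro sum.cong refl) (simp add: proots_linear_factor)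
    also have "\<dots> = image_mset (\<lambda>m. of_real (h m)) (mset_set {..<M})"
      by (simp add: sum_unfold_sum_mset)
    finally show ?thesis by (simp add: multiset.map_comp comp_def)
  qed
  have "image_mset of_real (image_mset e (mset_set {..<M})) =
      (image_mset of_real (image_mset l (mset_set {..<M})) :: 'a multiset)"
    using roots[OF e] roots[OF l] by simp
  then have "image_mset e (mset_set {..<M}) = image_mset l (mset_set {..<M})"
    using multiset.inj_map[of "of_real :: real \<Rightarrow> 'a"] by (simp add: inj_def)
  then show ?thesis
    using e l m by (intro antimono_on_eq_if_image_mset_eq[of "{..<M}"]) (auto simp: has_spectrum_def)
qed

section \<open>Rotating a vector to its canonical form\<close>

text \<open>
  The columns of \<open>H\<close> are orthonormal, and the one at \<open>s\<close> points along \<open>g\<close>. After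
  dividing a nonzero \<open>g\<close> by its length and by the phase of \<open>g s\<close>, its entry at \<open>s\<close> is real, and the reflection
  exchanging the result \<open>u\<close> with the basis vector does it; the phase is multiplied back.
\<close>

lemma householder:
  fixes g :: "nat \<Rightarrow> 'a::real_or_complex"
  assumes fin: "finite S" and s: "s \<in> S"
  shows "\<exists>H \<rho>. 0 \<le> \<rho> \<and>
    (\<forall>i\<in>S. \<forall>j\<in>S. (\<Sum>k\<in>S. conjugate (H k i) * H k j) = (if i = j then 1 else 0)) \<and>
    (\<forall>i\<in>S. H i s * of_real \<rho> = g i) \<and> of_real (\<rho>\<^sup>2) = (\<Sum>k\<in>S. g k * conjugate (g k))"
proof -
  define n where "n = (\<Sum>k\<in>S. norm_sq (g k))"
  have n: "0 \<le> n" by (simp add: n_def sum_nonneg norm_sq_nonneg)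
  have sum_g: "(\<Sum>k\<in>S. g k * conjugate (g k)) = of_real n"
    by (simp add: mult_conjugate n_def)
  show ?thesis
  proof (cases "n = 0")
    case True
    then have "\<forall>k\<in>S. g k = 0"
      using sum_nonneg_eq_0_iff[OF fin, of "\<lambda>k. norm_sq (g k)"] norm_sq_nonneg by (auto simp: n_def)
    moreover have "(\<Sum>k\<in>S. conjugate (if k = i then 1 else 0) * (if k = j then 1 else (0::'a))) =
        (if i = j then 1 else 0)" if "i \<in> S" "j \<in> S" for i j
    proof -
      have "(\<Sum>k\<in>S. conjugate (if k = i then 1 else 0) * (if k = j then 1 else (0::'a))) =
          (\<Sum>k\<in>S. if k = i then (if i = j then 1 else 0) else 0)"
        by (intro sum.cong) auto
      then show ?thesis using fin that by simp
    qed
    ultimately show ?thesis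
      using sum_g True
      by (intro exI[of _ "\<lambda>k j. if k = j then 1 else 0"] exI[of _ "0::real"]) simp
  next
    case False
    define \<rho> where "\<rho> = sqrt n"
    have \<rho>: "0 < \<rho>" "\<rho>\<^sup>2 = n" using n False by (simp_all add: \<rho>_def)
    obtain \<phi> c where c: "0 \<le> c" "g s = \<phi> * of_real c" "\<phi> * conjugate \<phi> = 1"
      by (rule polar_form)
    \<comment> \<open>Half the squared norm of \<open>w\<close> is \<open>1 - c / \<rho>\<close>. If this is \<open>0\<close>, then \<open>w = 0\<close> and, as \<open>1 / 0 = 0\<close>, the formula for \<open>H\<close> gives \<open>\<phi>\<close> times the identity.\<close>
    define t where "t = 1 / (1 - c / \<rho>)"
    define u where "u k = conjugate \<phi> * g k * of_real (1 / \<rho>)" for k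
    define w where "w k = u k - (if k = s then 1 else 0)" for k
    define H where "H k j = \<phi> * ((if k = j then 1 else 0) - of_real t * (w k * conjugate (w j)))" for k j
    have u_s: "u s = of_real (c / \<rho>)"
      using c(3) by (simp add: u_def c(2) mult_ac)
    have "u k * conjugate (u k) = g k * conjugate (g k) * of_real (1 / n)" for k
    proof -
      have "conjugate (u k) = \<phi> * conjugate (g k) * of_real (1 / \<rho>)"
        by (simp only: u_def conjugate_dist_mul conjugate_of_real conjugate_id)
      then have "u k * conjugate (u k) =
          (\<phi> * conjugate \<phi>) * (g k * conjugate (g k)) * of_real (1 / \<rho> * (1 / \<rho>))"
        by (simp only: u_def of_real_mult mult_ac)
      moreover have "1 / \<rho> * (1 / \<rho>) = 1 / n" using \<rho>(2) by (simp add: power2_eq_square)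
      ultimately show ?thesis by (simp only: c(3) mult_1)
    qed
    then have "(\<Sum>k\<in>S. u k * conjugate (u k)) = (\<Sum>k\<in>S. g k * conjugate (g k)) * of_real (1 / n)"
      by (simp add: sum_divide_distrib)
    also have "\<dots> = 1" using False by (simp add: sum_g)
    finally have sum_u: "(\<Sum>k\<in>S. u k * conjugate (u k)) = 1" .
    have "w k * conjugate (w k) = u k * conjugate (u k) + (if k = s then 1 - u s - conjugate (u s) else 0)" for k
      by (cases "k = s") (simp_all add: w_def conjugate_diff algebra_simps)
    then have "(\<Sum>k\<in>S. w k * conjugate (w k)) = 1 + (1 - u s - conjugate (u s))"
      using fin s by (simp add: sum.distrib sum_u)
    moreover have "conjugate (u s) = of_real (c / \<rho>)" unfolding u_s by (rule conjugate_of_real)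
    ultimately have sum_w: "(\<Sum>k\<in>S. w k * conjugate (w k)) = of_real (2 * (1 - c / \<rho>))"
      by (simp only: u_s) simp
    have t: "t * t * (2 * (1 - c / \<rho>)) = 2 * t"
    proof -
      have "1 / d * (1 / d) * (2 * d) = 2 * (1 / d)" for d :: real by (cases "d = 0") simp_all
      then show ?thesis unfolding t_def .
    qed
    have columns: "(\<Sum>k\<in>S. conjugate (H k i) * H k j) = (if i = j then 1 else 0)"
      if ij: "i \<in> S" "j \<in> S" for i j
    proof -
      let ?T = "of_real t :: 'a" and ?e = "\<lambda>k j. if k = j then 1 else 0 :: 'a"
      have conj_H: "conjugate (H k i) = conjugate \<phi> * (?e k i - ?T * (conjugate (w k) * w i))" for k
      proof -
        have "conjugate (?e k i) = ?e k i" by simp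
        then show ?thesis
          by (simp only: H_def conjugate_diff conjugate_dist_mul conjugate_of_real conjugate_id)
      qed
      have "conjugate (H k i) * H k j =
          (if k = i then ?e i j - ?T * (w i * conjugate (w j)) else 0) -
          (if k = j then ?T * (w i * conjugate (w j)) else 0) +
          (w k * conjugate (w k)) * (?T * ?T * (w i * conjugate (w j)))" (is "_ = ?r") for k
      proof -
        have "conjugate (H k i) * H k j = (\<phi> * conjugate \<phi>) *
            ((?e k i - ?T * (conjugate (w k) * w i)) * (?e k j - ?T * (w k * conjugate (w j))))"
          unfolding conj_H by (simp only: H_def mult_ac)
        also have "\<dots> = (?e k i - ?T * (conjugate (w k) * w i)) * (?e k j - ?T * (w k * conjugate (w j)))"
          by (simp only: c(3) mult_1)
        also have "\<dots> = ?r"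
          by (cases "k = i"; cases "k = j") (simp_all add: algebra_simps)
        finally show ?thesis .
      qed
      then have "(\<Sum>k\<in>S. conjugate (H k i) * H k j) =
          (?e i j - ?T * (w i * conjugate (w j))) - ?T * (w i * conjugate (w j)) +
          (\<Sum>k\<in>S. w k * conjugate (w k)) * (?T * ?T * (w i * conjugate (w j)))"
        using fin ij by (simp add: sum.distrib sum_subtractf sum_distrib_right)
      also have "(\<Sum>k\<in>S. w k * conjugate (w k)) * (?T * ?T * (w i * conjugate (w j))) =
          of_real (t * t * (2 * (1 - c / \<rho>))) * (w i * conjugate (w j))"
        unfolding sum_w of_real_mult by (simp only: mult_ac)
      finally show ?thesis unfolding t by (simp add: algebra_simps)
    qed
    have first: "H i s * of_real \<rho> = g i" if i: "i \<in> S" for i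
    proof -
      have w_s: "conjugate (w s) = of_real (c / \<rho> - 1)"
        unfolding w_def u_s
        by (simp only: conjugate_diff conjugate_of_real conjugate_one if_True refl of_real_diff of_real_1)
      have "w i = 0" if "c / \<rho> = 1"
      proof -
        have "(\<Sum>k\<in>S. of_real (norm_sq (w k))) = (0 :: 'a)"
          using sum_w that by (simp add: mult_conjugate)
        then have "(\<Sum>k\<in>S. norm_sq (w k)) = 0"
          by (simp flip: of_real_sum)
        then show ?thesis
          using sum_nonneg_eq_0_iff[OF fin, of "\<lambda>k. norm_sq (w k)"] norm_sq_nonneg i by auto
      qed
      then have "of_real t * (w i * conjugate (w s)) = - w i"
      proof (cases "c / \<rho> = 1")
        case False
        have "1 / d * - d = -1" if "d \<noteq> 0" for d :: real using that by simp
        from this[of "1 - c / \<rho>"] False have t1: "t * (c / \<rho> - 1) = -1"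
          by (simp only: t_def minus_diff_eq)
        have "of_real t * (w i * conjugate (w s)) = of_real (t * (c / \<rho> - 1)) * w i"
          unfolding w_s of_real_mult by (simp only: mult_ac)
        then show ?thesis unfolding t1 by simp
      qed simp
      then have "H i s = \<phi> * u i" by (simp add: H_def w_def)
      then have "H i s * of_real \<rho> = (\<phi> * conjugate \<phi>) * g i * of_real (1 / \<rho> * \<rho>)"
        by (simp only: u_def of_real_mult mult_ac)
      then show ?thesis using \<rho>(1) by (simp add: c(3))
    qed
    show ?thesis
      using \<rho> columns first sum_g by (intro exI[of _ H] exI[of _ \<rho>]) simp
  qed
qed

text \<open>
  One reflection per block. The indices \<open>m\<close> with \<open>\<forall>l<m. a m < a l\<close> are the first ones of the blocks.
\<close>

lemma exists_block_rotation:
  fixes g :: "'a::real_or_complex vec"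
  assumes a: "antimono_on {..<M} a" and g: "g \<in> carrier_vec M"
  obtains V \<rho> where "block_unitary M a V" and "\<And>m. m < M \<Longrightarrow> 0 \<le> \<rho> m"
    and "V *\<^sub>v vec M (\<lambda>m. if \<forall>l<m. a m < a l then of_real (\<rho> m) else 0) = g"
proof -
  define S where "S x = {m. m < M \<and> a m = x}" for x
  define s where "s x = Min (S x)" for x
  have fin: "finite (S x)" for x by (simp add: S_def)
  have s_in: "s (a i) \<in> S (a i)" if "i < M" for i
    unfolding s_def using that by (intro Min_in fin) (auto simp: S_def)
  have first_iff: "(\<forall>l<i. a i < a l) \<longleftrightarrow> i = s (a i)" if i: "i < M" for i
  proof
    assume first: "\<forall>l<i. a i < a l"
    have "s (a i) \<le> i" unfolding s_def using i by (intro Min_le fin) (simp add: S_def)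
    moreover have "a (s (a i)) = a i" using s_in[OF i] by (simp add: S_def)
    ultimately show "i = s (a i)" using first by (metis le_neq_implies_less less_irrefl)
  next
    assume i_eq: "i = s (a i)"
    show "\<forall>l<i. a i < a l"
    proof (intro allI impI)
      fix l assume l: "l < i"
      then have "l \<notin> S (a i)" using Min_le[OF fin, of l "a i"] i_eq by (auto simp: s_def)
      then show "a i < a l" using monotone_onD[OF a, of l i] l i by (auto simp: S_def)
    qed
  qed
  let ?P = "\<lambda>x H \<rho>. 0 \<le> \<rho> \<and>
      (\<forall>i\<in>S x. \<forall>j\<in>S x. (\<Sum>k\<in>S x. conjugate (H k i) * H k j) = (if i = j then 1 else 0)) \<and>
      (\<forall>i\<in>S x. H i (s x) * of_real \<rho> = g $ i)"
  have "\<exists>H \<rho>. ?P x H \<rho>" if x: "x \<in> a ` {..<M}" for x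
  proof -
    have "s x \<in> S x" using s_in x by auto
    from householder[OF fin this, of "\<lambda>i. g $ i"] show ?thesis by fast
  qed
  then have "\<forall>x\<in>a ` {..<M}. \<exists>y. ?P x (fst y) (snd y)" by simp
  from bchoice[OF this] obtain y where y: "\<forall>x\<in>a ` {..<M}. ?P x (fst (y x)) (snd (y x))" ..
  define H where "H x = fst (y x)" for x
  define \<rho> where "\<rho> x = snd (y x)" for x
  have H: "\<And>x. x \<in> a ` {..<M} \<Longrightarrow> 0 \<le> \<rho> x"
    "\<And>x i j. x \<in> a ` {..<M} \<Longrightarrow> i \<in> S x \<Longrightarrow> j \<in> S x \<Longrightarrow>
      (\<Sum>k\<in>S x. conjugate (H x k i) * H x k j) = (if i = j then 1 else 0)"
    "\<And>x i. x \<in> a ` {..<M} \<Longrightarrow> i \<in> S x \<Longrightarrow> H x i (s x) * of_real (\<rho> x) = g $ i"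
    using y unfolding H_def \<rho>_def by blast+
  define V where "V = mat M M (\<lambda>(i, j). if a i = a j then H (a i) i j else 0)"
  have V: "V \<in> carrier_mat M M" by (simp add: V_def)
  have "unitary_mat M V"
    unfolding unitary_mat_iff_columns[OF V]
  proof (intro allI impI)
    fix i j assume ij: "i < M" "j < M"
    show "(\<Sum>k<M. conjugate (V $$ (k, i)) * V $$ (k, j)) = (if i = j then 1 else 0)"
    proof (cases "a i = a j")
      case True
      have "(\<Sum>k<M. conjugate (V $$ (k, i)) * V $$ (k, j)) =
          (\<Sum>k\<in>S (a i). conjugate (V $$ (k, i)) * V $$ (k, j))"
        using ij by (intro sum.mono_neutral_right) (auto simp: V_def S_def)
      also have "\<dots> = (\<Sum>k\<in>S (a i). conjugate (H (a i) k i) * H (a i) k j)"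
        using ij True by (intro sum.cong) (auto simp: V_def S_def)
      also have "\<dots> = (if i = j then 1 else 0)"
        using ij True by (intro H(2)) (auto simp: S_def)
      finally show ?thesis .
    next
      case False
      then have "(\<Sum>k<M. conjugate (V $$ (k, i)) * V $$ (k, j)) = 0"
        using ij by (intro sum.neutral) (auto simp: V_def)
      then show ?thesis using False by auto
    qed
  qed
  then have "block_unitary M a V"
    unfolding block_unitary_iff[OF a] by (simp add: V_def)
  moreover have "0 \<le> \<rho> (a m)" if "m < M" for m using H(1) that by simp
  moreover have "V *\<^sub>v vec M (\<lambda>m. if \<forall>l<m. a m < a l then of_real (\<rho> (a m)) else 0) = g"
  proof (rule eq_vecI)
    fix i assume "i < dim_vec g"
    then have i: "i < M" using g by simp
    have "(V *\<^sub>v vec M (\<lambda>m. if \<forall>l<m. a m < a l then of_real (\<rho> (a m)) else 0)) $ i =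
        (\<Sum>m<M. V $$ (i, m) * (if m = s (a m) then of_real (\<rho> (a m)) else 0))"
      using i V first_iff by (auto simp: scalar_prod_def lessThan_atLeast0 intro!: sum.cong)
    also have "\<dots> = (\<Sum>m<M. if m = s (a i) then H (a i) i m * of_real (\<rho> (a i)) else 0)"
    proof (rule sum.cong)
      fix m assume "m \<in> {..<M}"
      then show "V $$ (i, m) * (if m = s (a m) then of_real (\<rho> (a m)) else 0) =
          (if m = s (a i) then H (a i) i m * of_real (\<rho> (a i)) else 0)"
        using i s_in[OF i] by (auto simp: V_def S_def)
    qed simp
    also have "\<dots> = H (a i) i (s (a i)) * of_real (\<rho> (a i))"
      using s_in[OF i] by (simp add: S_def)
    also have "\<dots> = g $ i" using i by (intro H(3)) (auto simp: S_def)
    finally show "(V *\<^sub>v vec M (\<lambda>m. if \<forall>l<m. a m < a l then of_real (\<rho> (a m)) else 0)) $ i = g $ i" .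
  qed (use g V in simp)
  ultimately show ?thesis by (rule that)
qed

section \<open>Existence of the next eigenstep\<close>

lemma exists_antimono_values:
  fixes B :: "real multiset"
  assumes "size B = M"
  obtains b where "antimono_on {..<M} b" and "values_mset M b = B"
proof
  define xs where "xs = rev (sorted_list_of_multiset B)"
  have xs: "mset xs = B" "sorted (rev xs)" by (simp_all add: xs_def)
  then have len: "length xs = M" using assms by (metis size_mset)
  show "antimono_on {..<M} (\<lambda>m. xs ! m)"
    using sorted_rev_nth_mono[OF xs(2)] len by (auto intro!: monotone_onI)
  have "mset (map (\<lambda>m. xs ! m) [0..<length xs]) = mset xs" by (simp add: map_nth)
  then show "values_mset M (\<lambda>m. xs ! m) = B"
    by (simp add: values_mset_def xs(1) len lessThan_atLeast0)
qed

text \<open>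
  Every nonnegative vector supported on the first indices of the blocks is the vector of a step: the
  roots of the secular polynomial replace the values at the support \<open>K\<close>, and \<open>K\<close> becomes the set
  of excess indices because the roots avoid the replaced values. The factorization
  of the secular polynomial then says that the radicand of \<open>v\<close> at \<open>k\<close> is \<open>\<rho>\<^sub>k\<^sup>2\<close>.
\<close>

lemma exists_secular_eigenvalues:
  fixes a \<rho> :: "nat \<Rightarrow> real"
  assumes a: "antimono_on {..<M} a" and \<rho>: "\<And>m. m < M \<Longrightarrow> 0 \<le> \<rho> m"
  obtains b where "antimono_on {..<M} b" and "interlaces M a b"
    and "\<forall>m<M. step_vec M a b m = (if \<forall>l<m. a m < a l then \<rho> m else 0)"
proof -
  define K where "K = {m. m < M \<and> (\<forall>l<m. a m < a l) \<and> \<rho> m \<noteq> 0}"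
  have fin: "finite K" and K: "K \<subseteq> {..<M}" by (auto simp: K_def)
  have pos: "0 < \<rho> k" if "k \<in> K" for k using that \<rho>[of k] by (auto simp: K_def less_le)
  obtain r where r: "\<And>k. k \<in> K \<Longrightarrow> a k < r k"
    "\<And>k l. k \<in> K \<Longrightarrow> l \<in> K \<Longrightarrow> k < l \<Longrightarrow> r l < a k"
    "\<And>k. k \<in> K \<Longrightarrow> (\<Prod>l\<in>K. a k - r l) = - (\<rho> k)\<^sup>2 * (\<Prod>l\<in>K - {k}. a k - a l)"
  proof (rule secular_roots[OF fin, of a "\<lambda>k. (\<rho> k)\<^sup>2"])
    show "a l < a k" if "k \<in> K" "l \<in> K" "k < l" for k l using that by (auto simp: K_def)
    show "0 < (\<rho> k)\<^sup>2" if "k \<in> K" for k using pos[OF that] by simp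
  qed blast
  have inj_a: "inj_on a K"
  proof (rule inj_onI)
    fix k l assume "k \<in> K" "l \<in> K" "a k = a l"
    then show "k = l" by (cases k l rule: linorder_cases) (auto simp: K_def)
  qed
  have disjoint: "a k \<noteq> r l" if "k \<in> K" "l \<in> K" for k l
  proof (cases k l rule: linorder_cases)
    case less
    then show ?thesis using r(2)[OF that less] by simp
  next
    case equal
    then show ?thesis using r(1)[OF that(1)] by simp
  next
    case greater
    then show ?thesis using r(1)[OF that(1)] r(1)[OF that(2)] r(2)[OF that(2,1) greater] by simp
  qed
  define A R C where "A = image_mset a (mset_set K)" and "R = image_mset r (mset_set K)"
    and "C = image_mset a (mset_set ({..<M} - K))"
  have AR: "A \<inter># R = {#}"
    using disjoint fin by (auto simp: A_def R_def disjunct_not_in)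
  have "mset_set {..<M} = mset_set K + mset_set ({..<M} - K)"
    using K fin by (metis Diff_disjoint Diff_partition finite_Diff finite_lessThan mset_set_Union)
  then have Ma: "values_mset M a = A + C" by (simp add: values_mset_def A_def C_def)
  have "size (R + C) = size (values_mset M a)" unfolding Ma by (simp add: A_def R_def)
  then have "size (R + C) = M" by simp
  then obtain b where b: "antimono_on {..<M} b" and Mb: "values_mset M b = R + C"
    by (rule exists_antimono_values)
  have counts: "card {k \<in> K. x < a k} \<le> card {k \<in> K. x < r k}"
    "card {k \<in> K. x < r k} \<le> Suc (card {k \<in> K. x < a k})" for x
  proof -
    have sub: "{k \<in> K. x < a k} \<subseteq> {k \<in> K. x < r k}"
      by (auto intro: order.strict_trans[OF _ r(1)])
    then show "card {k \<in> K. x < a k} \<le> card {k \<in> K. x < r k}"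
      using fin by (intro card_mono) auto
    \<comment> \<open>Intervals from \<open>a k\<close> to \<open>r k\<close> are disjoint, so at most one of them contains the threshold \<open>x\<close>.\<close>
    let ?D = "{k \<in> K. x < r k} - {k \<in> K. x < a k}"
    have "k = l" if "k \<in> ?D" "l \<in> ?D" for k l
    proof (rule ccontr)
      assume "k \<noteq> l"
      then consider "k < l" | "l < k" by linarith
      moreover have "k \<in> K" "x < r k" "a k \<le> x" "l \<in> K" "x < r l" "a l \<le> x"
        using that by auto
      ultimately show False using r(2)[of k l] r(2)[of l k] by cases auto
    qed
    then have "card ?D \<le> 1" by (simp add: card_le_Suc0_iff_eq fin)
    moreover have "card ?D = card {k \<in> K. x < r k} - card {k \<in> K. x < a k}"
      using sub fin by (intro card_Diff_subset) auto
    ultimately show "card {k \<in> K. x < r k} \<le> Suc (card {k \<in> K. x < a k})" by simp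
  qed
  have ab: "interlaces M a b"
    using counts by (intro counts_imp_interlaces a b)
      (simp_all add: Ma Mb A_def R_def size_filter_image_mset_set fin)
  have I: "excess_indices M a b = K"
  proof -
    have "multiplicity_in M b (a m) < multiplicity_in M a (a m) \<longleftrightarrow> a m \<in># A" for m
    proof -
      have "count R (a m) = 0" if "a m \<in># A"
        using that AR by (auto simp: disjunct_not_in count_eq_zero_iff)
      moreover have "count A (a m) = 0" if "a m \<notin># A" using that by (simp add: count_eq_zero_iff)
      moreover have "count A (a m) \<noteq> 0" if "a m \<in># A" using that by simp
      ultimately show ?thesis
        unfolding count_values_mset[symmetric] Ma Mb count_union by (cases "a m \<in># A") simp_all
    qed
    then have "excess_indices M a b = {m. m < M \<and> (\<forall>l<m. a m < a l) \<and> a m \<in># A}"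
      unfolding excess_indices_def by simp
    also have "\<dots> = {m. m < M \<and> (\<forall>l<m. a m < a l) \<and> a m \<in> a ` K}"
      using fin by (simp add: A_def)
    also have "\<dots> = K"
    proof
      show "{m. m < M \<and> (\<forall>l<m. a m < a l) \<and> a m \<in> a ` K} \<subseteq> K"
      proof
        fix m assume "m \<in> {m. m < M \<and> (\<forall>l<m. a m < a l) \<and> a m \<in> a ` K}"
        then obtain k where m: "\<forall>l<m. a m < a l" and k: "k \<in> K" "a m = a k" by auto
        then have "m = k" by (cases m k rule: linorder_cases) (auto simp: K_def)
        then show "m \<in> K" using k by simp
      qed
    qed (auto simp: K_def)
    finally show ?thesis .
  qed
  have "image_mset b (mset_set (excess_indices M b a)) = values_mset M b - values_mset M a"
    using interlaces_imp_multiplicity(2)[OF ab] by (rule image_mset_excess_indices[OF b])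
  also have "\<dots> = R - A" by (simp add: Ma Mb)
  also have "\<dots> = R"
  proof (rule multiset_eqI)
    fix x
    have "min (count A x) (count R x) = 0" using arg_cong[OF AR, of "\<lambda>B. count B x"] by simp
    then show "count (R - A) x = count R x" by (cases "count A x") (auto simp: min_def split: if_splits)
  qed
  finally have J: "image_mset b (mset_set (excess_indices M b a)) = R" .
  have "(\<Prod>j\<in>excess_indices M b a. x - b j) = (\<Prod>k\<in>K. x - r k)" for x
  proof -
    have "(\<Prod>j\<in>excess_indices M b a. x - b j) =
        prod_mset (image_mset (\<lambda>y. x - y) (image_mset b (mset_set (excess_indices M b a))))"
      by (simp add: prod_unfold_prod_mset multiset.map_comp comp_def)
    also have "\<dots> = (\<Prod>k\<in>K. x - r k)"
      unfolding J R_def by (simp add: prod_unfold_prod_mset multiset.map_comp comp_def)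
    finally show ?thesis .
  qed
  then have v: "v_entry K (excess_indices M b a) a b k = \<rho> k" if k: "k \<in> K" for k
  proof -
    have "(\<Prod>l\<in>K - {k}. a k - a l) \<noteq> 0" using fin inj_a k by (auto dest: inj_onD)
    then show ?thesis
      using \<open>\<And>x. (\<Prod>j\<in>excess_indices M b a. x - b j) = (\<Prod>k\<in>K. x - r k)\<close> pos[OF k]
      by (simp add: v_entry_def r(3)[OF k])
  qed
  have "step_vec M a b m = (if \<forall>l<m. a m < a l then \<rho> m else 0)" if m: "m < M" for m
  proof (cases "m \<in> K")
    case True
    then show ?thesis using v[OF True] by (auto simp: step_vec_def I K_def)
  next
    case False
    then show ?thesis using m by (auto simp: step_vec_def I K_def)
  qed
  with b ab show ?thesis using that by blast
qed

text \<open>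
  \<open>V\<close> comes from the canonical form of \<open>U\<^sup>* f\<close>, and \<open>b\<close> from the roots belonging to that canonical
  form; the step then returns \<open>U (U\<^sup>* f) = f\<close>.
\<close>

lemma exists_eigenstep:
  fixes f :: "'a::real_or_complex vec"
  assumes a: "antimono_on {..<M} a" and U: "unitary_mat M U" and f: "f \<in> carrier_vec M"
  obtains b V where "antimono_on {..<M} b" and "interlaces M a b" and "block_unitary M a V"
    and "next_vector M a b U V = f"
proof -
  have c: "U \<in> carrier_mat M M" "mat_adjoint U \<in> carrier_mat M M" "U * mat_adjoint U = 1\<^sub>m M"
    using U by (auto simp: unitary_mat_def)
  have "mat_adjoint U *\<^sub>v f \<in> carrier_vec M" using mult_mat_vec_carrier[OF c(2) f] .
  then obtain V \<rho> where V: "block_unitary M a V" and \<rho>: "\<And>m. m < M \<Longrightarrow> 0 \<le> \<rho> m"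
    and Vg: "V *\<^sub>v vec M (\<lambda>m. if \<forall>l<m. a m < a l then of_real (\<rho> m) else 0) = mat_adjoint U *\<^sub>v f"
    by (rule exists_block_rotation[OF a]) blast
  obtain b where b: "antimono_on {..<M} b" and ab: "interlaces M a b"
    and step: "\<forall>m<M. step_vec M a b m = (if \<forall>l<m. a m < a l then \<rho> m else 0)"
    by (rule exists_secular_eigenvalues[OF a \<rho>])
  have Vc: "V \<in> carrier_mat M M" using V by (simp add: block_unitary_def unitary_mat_def)
  have "vec M (\<lambda>m. of_real (step_vec M a b m)) =
      (vec M (\<lambda>m. if \<forall>l<m. a m < a l then of_real (\<rho> m) else 0) :: 'a vec)"
    using step by (intro eq_vecI) auto
  then have "next_vector M a b U V =
      U * V *\<^sub>v vec M (\<lambda>m. if \<forall>l<m. a m < a l then of_real (\<rho> m) else 0)"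
    by (simp only: next_vector_eq[OF c(1) Vc])
  also have "\<dots> = U *\<^sub>v (mat_adjoint U *\<^sub>v f)"
    using assoc_mult_mat_vec[OF c(1) Vc] by (simp add: Vg)
  also have "\<dots> = f"
    using assoc_mult_mat_vec[OF c(1,2) f] f by (simp add: c(3))
  finally show ?thesis using that b ab V by blast
qed

section \<open>Correctness and completeness of the algorithm\<close>

lemma frame_operator_0: "frame_operator M 0 f = 0\<^sub>m M M"
  by (rule eq_matI) (simp_all add: frame_operator_eq)

lemma frame_operator_cong:
  assumes "\<And>k. k \<in> {1..n} \<Longrightarrow> f k = g k"
  shows "frame_operator M n f = frame_operator M n g"
  unfolding frame_operator_eq using assms by (intro eq_matI) auto

lemma diagonalizes_zero:
  assumes "unitary_mat M U" and "\<And>m. m < M \<Longrightarrow> e m = 0"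
  shows "diagonalizes M (0\<^sub>m M M) e (U :: 'a::real_or_complex mat)"
proof -
  have U: "U \<in> carrier_mat M M" using assms(1) by (simp add: unitary_mat_def)
  have "antimono_on {..<M} e" by (rule monotone_onI) (simp add: assms(2))
  moreover have "0\<^sub>m M M * U = U * mat_diag M (\<lambda>m. of_real (e m))"
    unfolding mat_diag_mult_right[OF U] using U by (intro eq_matI) (auto simp: assms(2))
  ultimately show ?thesis using assms(1) by (simp add: diagonalizes_def)
qed

text \<open>
  The base case: with a single vector, the matrix \<open>U\<close> diagonalizes the frame operator, whose only
  possible nonzero eigenvalue belongs to the first column.
\<close>

lemma diagonalizes_rank_one:
  fixes U :: "'a::real_or_complex mat"
  assumes U: "unitary_mat M U" and c: "0 \<le> c" and e: "e 0 = c" "\<And>m. 0 < m \<Longrightarrow> m < M \<Longrightarrow> e m = 0"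
  shows "diagonalizes M (outer_product (of_real (sqrt c) \<cdot>\<^sub>v col U 0)) e U"
proof -
  let ?D = "mat_diag M (\<lambda>m. of_real (e m)) :: 'a mat"
  have Uc: "U \<in> carrier_mat M M" "mat_adjoint U \<in> carrier_mat M M" "mat_adjoint U * U = 1\<^sub>m M"
    using U by (auto simp: unitary_mat_def)
  define g :: "'a vec" where "g = vec M (\<lambda>i. if i = 0 then of_real (sqrt c) else 0)"
  have g: "g \<in> carrier_vec M" by (simp add: g_def)
  have f: "of_real (sqrt c) \<cdot>\<^sub>v col U 0 = U *\<^sub>v g" if "0 < M"
  proof (rule eq_vecI)
    fix i assume "i < dim_vec (U *\<^sub>v g)"
    then have i: "i < M" using Uc by simp
    have "(U *\<^sub>v g) $ i = (\<Sum>k<M. U $$ (i, k) * (if k = 0 then of_real (sqrt c) else 0))"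
      using i Uc by (simp add: g_def scalar_prod_def lessThan_atLeast0)
    also have "\<dots> = (\<Sum>k<M. if k = 0 then U $$ (i, k) * of_real (sqrt c) else 0)"
      by (intro sum.cong) auto
    finally show "(of_real (sqrt c) \<cdot>\<^sub>v col U 0) $ i = (U *\<^sub>v g) $ i"
      using i Uc that by (simp add: mult.commute)
  qed (use Uc in simp)
  have D: "outer_product g = ?D"
  proof (rule eq_matI)
    fix i j assume "i < dim_row ?D" "j < dim_col ?D"
    then have ij: "i < M" "j < M" by (auto simp: mat_diag_def)
    have "of_real (sqrt c) * of_real (sqrt c) = (of_real c :: 'a)"
      using c by (simp flip: of_real_mult)
    then show "outer_product g $$ (i, j) = ?D $$ (i, j)"
      using ij e by (auto simp: outer_product_def g_def mat_diag_def)
  qed (simp_all add: g_def mat_diag_def)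
  have "outer_product (of_real (sqrt c) \<cdot>\<^sub>v col U 0) * U = U * ?D"
  proof (cases "M = 0")
    case True
    then show ?thesis using Uc by (intro eq_matI) (auto simp: mat_diag_def)
  next
    case False
    then have "outer_product (of_real (sqrt c) \<cdot>\<^sub>v col U 0) * U = U * ?D * mat_adjoint U * U"
      using f outer_product_mult_mat_vec[OF Uc(1) g] D by simp
    also have "\<dots> = U * ?D * (mat_adjoint U * U)"
      by (rule assoc_mult_mat[OF mult_carrier_mat[OF Uc(1) mat_diag_dim] Uc(2,1)])
    also have "\<dots> = U * ?D"
      using right_mult_one_mat[OF mult_carrier_mat[OF Uc(1) mat_diag_dim]] by (simp add: Uc(3))
    finally show ?thesis .
  qed
  moreover have "antimono_on {..<M} e"
  proof (rule monotone_onI)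
    fix k l assume "k \<in> {..<M}" "l \<in> {..<M}" "k \<le> l"
    then show "e l \<le> e k" using c e by (cases "k = 0"; cases "l = 0") auto
  qed
  moreover have "outer_product (of_real (sqrt c) \<cdot>\<^sub>v col U 0) \<in> carrier_mat M M"
    using Uc by (intro outer_product_carrier) (auto intro: carrier_vecI)
  ultimately show ?thesis using U by (simp add: diagonalizes_def)
qed

lemma exists_unitary_first_column:
  fixes f :: "'a::real_or_complex vec"
  assumes f: "f \<in> carrier_vec M" and M: "M \<ge> 1" and c: "f \<bullet>c f = of_real c"
  obtains U where "unitary_mat M U" and "f = of_real (sqrt c) \<cdot>\<^sub>v col U 0"
proof -
  have "0 \<in> {..<M}" using M by simp
  from householder[OF finite_lessThan this, of "\<lambda>i. f $ i"] obtain H \<rho> where \<rho>: "0 \<le> \<rho>"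
    and H: "\<forall>i\<in>{..<M}. \<forall>j\<in>{..<M}.
      (\<Sum>k<M. conjugate (H k i) * H k j) = (if i = j then 1 else 0)"
      "\<forall>i\<in>{..<M}. H i 0 * of_real \<rho> = f $ i"
    and sq: "of_real (\<rho>\<^sup>2) = (\<Sum>k<M. f $ k * conjugate (f $ k))" by blast
  define U where "U = mat M M (\<lambda>(i, j). H i j)"
  have U: "U \<in> carrier_mat M M" by (simp add: U_def)
  have "unitary_mat M U"
    unfolding unitary_mat_iff_columns[OF U] using H(1) by (simp add: U_def)
  moreover have "(of_real (\<rho>\<^sup>2) :: 'a) = of_real c"
    using sq c scalar_prod_conjugate_eq_sum[OF f] by simp
  then have "\<rho>\<^sup>2 = c" by (simp only: of_real_eq_iff)
  then have "sqrt c = \<rho>" using \<rho> by (metis real_sqrt_unique)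
  moreover have "f = of_real \<rho> \<cdot>\<^sub>v col U 0"
    using f H(2) M by (intro eq_vecI) (auto simp: U_def mult.commute)
  ultimately show ?thesis using that by simp
qed

lemma eigensteps_antimono: "eigensteps M N lam mu E \<Longrightarrow> n \<le> N \<Longrightarrow> antimono_on {..<M} (E n)"
  by (simp add: eigensteps_def)

lemma eigensteps_interlaces:
  assumes "eigensteps M N lam mu E" and "n < N"
  shows "interlaces M (E n) (E (Suc n))"
proof -
  have "\<forall>n\<in>{1..N}. interlaces M (E (n - 1)) (E n)" using assms(1) unfolding eigensteps_def by blast
  from bspec[OF this, of "Suc n"] show ?thesis using assms(2) by simp
qed

lemma eigensteps_card_excess_indices:
  assumes E: "eigensteps M N lam mu E" and n: "n \<in> {1..<N}"
  shows "card (excess_indices M (E n) (E (Suc n))) = card (excess_indices M (E (Suc n)) (E n))"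
proof -
  interpret interlacing_nodes "excess_indices M (E n) (E (Suc n))" "excess_indices M (E (Suc n)) (E n)"
      "E n" "E (Suc n)"
    using n by (intro interlacing_nodes_excess_indices eigensteps_antimono[OF E] eigensteps_interlaces[OF E]) auto
  show ?thesis by (rule card_eq)
qed

lemma algorithm_run_diagonalizes:
  fixes f :: "nat \<Rightarrow> 'a::real_or_complex vec"
  assumes run: "algorithm_run M N lam mu E U V f" and M: "M \<ge> 1" and mu: "0 \<le> mu 1"
    and n: "1 \<le> n" "n \<le> N"
  shows "f n \<in> carrier_vec M \<and> diagonalizes M (frame_operator M n f) (E n) (U n)"
  using n
proof (induction n rule: nat_induct_at_least)
  case base
  have E: "\<And>m. m < M \<Longrightarrow> 0 \<le> E 1 m" "\<And>m. m < M \<Longrightarrow> E 0 m = 0" "interlaces M (E 0) (E 1)"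
    "(\<Sum>m<M. E 1 m) = mu 1" "unitary_mat M (U 1)"
    and f1: "f 1 = of_real (sqrt (mu 1)) \<cdot>\<^sub>v col (U 1) 0"
    using run base by (auto simp: algorithm_run_def eigensteps_def dest!: bspec[of _ _ 1])
  \<comment> \<open>Interlacing with the zero row leaves only the first entry of the first row free.\<close>
  have zero: "E 1 m = 0" if "0 < m" "m < M" for m
  proof -
    from that(1) obtain k where k: "m = Suc k" by (cases m) auto
    then have "E 1 m \<le> E 0 k" using E(3) that by (simp add: interlaces_def)
    then show ?thesis using E(1)[OF that(2)] E(2)[of k] k that by simp
  qed
  have "(\<Sum>m<M. E 1 m) = (\<Sum>m\<in>{0}. E 1 m)"
    using zero M by (intro sum.mono_neutral_right) auto
  then have "E 1 0 = mu 1" using E(4) by simp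
  then have d: "diagonalizes M (outer_product (f 1)) (E 1) (U 1)"
    unfolding f1 using zero by (intro diagonalizes_rank_one E mu)
  have "dim_row (U 1) = M" using E(5) by (auto simp: unitary_mat_def)
  then have f1c: "f 1 \<in> carrier_vec M" unfolding f1 by (intro carrier_vecI) simp
  have "frame_operator M 1 f = outer_product (f 1)"
    using frame_operator_Suc[of f 0 M] f1c outer_product_carrier[OF f1c]
    by (simp add: frame_operator_0)
  with d f1c show ?case by simp
next
  case (Suc n)
  then have n: "n \<in> {1..<N}" and IH: "diagonalizes M (frame_operator M n f) (E n) (U n)" by auto
  have V: "block_unitary M (E n) (V n)"
    and f: "f (Suc n) = next_vector M (E n) (E (Suc n)) (U n) (V n)"
    and U: "U (Suc n) = next_basis M (E n) (E (Suc n)) (U n) (V n)"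
    and E: "eigensteps M N lam mu E"
    using run n by (auto simp: algorithm_run_def)
  have ab: "interlaces M (E n) (E (Suc n))" and b: "antimono_on {..<M} (E (Suc n))"
    using n by (auto intro: eigensteps_interlaces[OF E] eigensteps_antimono[OF E])
  note step = diagonalizes_next_step[OF IH b ab V, folded f U]
  show ?case using step frame_operator_Suc[of f n M] by simp
qed

lemma diagonalizes_frame_operator_step:
  fixes f :: "nat \<Rightarrow> 'a::real_or_complex vec"
  assumes "diagonalizes M (frame_operator M n f) a U"
    and "diagonalizes M (frame_operator M (Suc n) f) b U'" and f: "f (Suc n) \<in> carrier_vec M"
  shows "f (Suc n) \<bullet>c f (Suc n) = of_real ((\<Sum>m<M. b m) - (\<Sum>m<M. a m))"
  using diagonalizes_rank_one_update_trace[OF assms(1) _ f] assms(2)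
  by (simp add: frame_operator_Suc[of f n M, OF f])

lemma algorithm_run_sound:
  fixes f :: "nat \<Rightarrow> 'a::real_or_complex vec"
  assumes run: "algorithm_run M N lam mu E U V f" and M: "M \<ge> 1" and N: "N \<ge> 1"
    and lam: "antimono_on {..<M} lam" and mu: "0 \<le> mu 1"
  shows "(\<forall>n\<in>{1..N}. f n \<in> carrier_vec M) \<and> has_spectrum_and_lengths M N lam mu f \<and>
    (\<forall>n\<in>{1..N}. has_spectrum M (frame_operator M n f) (E n) \<and>
      orthonormal_eigenbasis M (frame_operator M n f) (E n) (U n))"
proof -
  have E: "eigensteps M N lam mu E" and U1: "unitary_mat M (U 1)"
    using run by (auto simp: algorithm_run_def)
  have d: "f n \<in> carrier_vec M" "diagonalizes M (frame_operator M n f) (E n) (U n)" if "n \<in> {1..N}" for n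
    using algorithm_run_diagonalizes[where n = n, OF run M mu] that by auto
  have "has_spectrum M (frame_operator M N f) (E N)"
    using d(2)[of N] N by (intro diagonalizes_imp_has_spectrum) auto
  moreover have "E N m = lam m" if "m < M" for m using E that by (simp add: eigensteps_def)
  ultimately have spectrum: "has_spectrum M (frame_operator M N f) lam"
    using lam by (simp add: has_spectrum_def)
  have "f n \<bullet>c f n = of_real (mu n)" if n: "n \<in> {1..N}" for n
  proof -
    obtain k where k: "n = Suc k" using n by (cases n) auto
    have "\<exists>U. diagonalizes M (frame_operator M k f) (E k) U"
    proof (cases "k = 0")
      case True
      have "diagonalizes M (0\<^sub>m M M) (E 0) (U 1)"
        using E by (intro diagonalizes_zero U1) (simp add: eigensteps_def)
      then show ?thesis using True by (auto simp: frame_operator_0)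
    next
      case False
      then show ?thesis using d(2)[of k] n k by auto
    qed
    then obtain U' where "diagonalizes M (frame_operator M k f) (E k) U'" ..
    from diagonalizes_frame_operator_step[OF this d(2)[OF n, unfolded k] d(1)[OF n, unfolded k]]
    have "f n \<bullet>c f n = of_real ((\<Sum>m<M. E n m) - (\<Sum>m<M. E k m))" by (simp only: k)
    moreover have "(\<Sum>m<M. E j m) = (\<Sum>i=1..j. mu i)" if "j \<le> N" for j
      using E that by (cases "j = 0") (auto simp: eigensteps_def)
    then have "(\<Sum>m<M. E n m) - (\<Sum>m<M. E k m) = mu n" using n k by simp
    ultimately show ?thesis by (simp only:)
  qed
  with spectrum d show ?thesis
    unfolding has_spectrum_and_lengths_def
    by (auto intro: diagonalizes_imp_has_spectrum[OF d(2)] diagonalizes_imp_orthonormal_eigenbasis[OF d(2)])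
qed

text \<open>
  Rows of eigensteps and eigenbases are built together by dependent choice. The index is shifted by
  one, since the choice starts at \<open>0\<close> with data for a single vector, and the sequence is continued by
  zero vectors so that the choice never stops. The sums required of eigensteps come from
  the prescribed lengths by comparing traces.
\<close>

lemma algorithm_run_complete:
  fixes f :: "nat \<Rightarrow> 'a::real_or_complex vec"
  assumes M: "M \<ge> 1" and N: "N \<ge> 1" and mu: "0 \<le> mu 1"
    and f: "\<forall>n\<in>{1..N}. f n \<in> carrier_vec M" and spec: "has_spectrum_and_lengths M N lam mu f"
  shows "\<exists>E U V. algorithm_run M N lam mu E U V f"
proof -
  define h where "h n = (if n \<in> {1..N} then f n else 0\<^sub>v M)" for n
  have h: "h n \<in> carrier_vec M" for n using f by (simp add: h_def)
  have h_eq: "h n = f n" if "n \<in> {1..N}" for n using that by (simp only: h_def if_True)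
  let ?A = "\<lambda>n. frame_operator M n h"
  define P where "P k s \<longleftrightarrow> diagonalizes M (?A (Suc k)) (fst s) (snd s) \<and> (\<forall>m<M. 0 \<le> fst s m) \<and>
      (k = 0 \<longrightarrow> f 1 = of_real (sqrt (mu 1)) \<cdot>\<^sub>v col (snd s) 0 \<and> interlaces M (\<lambda>_. 0) (fst s))"
    for k and s :: "(nat \<Rightarrow> real) \<times> 'a mat"
  define Q where "Q k s s' \<longleftrightarrow> interlaces M (fst s) (fst s') \<and> (\<exists>V. block_unitary M (fst s) V \<and>
      h (Suc (Suc k)) = next_vector M (fst s) (fst s') (snd s) V \<and>
      snd s' = next_basis M (fst s) (fst s') (snd s) V)"
    for k and s s' :: "(nat \<Rightarrow> real) \<times> 'a mat"
  have "\<exists>F. \<forall>k. P k (F k) \<and> Q k (F k) (F (Suc k))"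
  proof (rule dependent_nat_choice)
    have f1: "f 1 \<in> carrier_vec M" "f 1 \<bullet>c f 1 = of_real (mu 1)"
      using f spec N by (auto simp: has_spectrum_and_lengths_def)
    then obtain U where U: "unitary_mat M U" "f 1 = of_real (sqrt (mu 1)) \<cdot>\<^sub>v col U 0"
      using exists_unitary_first_column[OF _ M] by blast
    let ?e = "\<lambda>m::nat. if m = 0 then mu 1 else 0"
    have "diagonalizes M (outer_product (f 1)) ?e U"
      unfolding U(2) by (rule diagonalizes_rank_one[OF U(1) mu]) simp_all
    moreover have "?A 1 = outer_product (f 1)"
      using frame_operator_Suc[of h 0 M] h_eq[of 1] N f1(1) outer_product_carrier[OF f1(1)]
      by (simp add: frame_operator_0)
    moreover have "interlaces M (\<lambda>_. 0) ?e" using mu by (simp add: interlaces_def)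
    ultimately have "P 0 (?e, U)" using U(2) mu by (simp add: P_def)
    then show "\<exists>s. P 0 s" ..
  next
    fix s k assume "P k s"
    then have d: "diagonalizes M (?A (Suc k)) (fst s) (snd s)" and nonneg: "\<forall>m<M. 0 \<le> fst s m"
      by (auto simp: P_def)
    then have "antimono_on {..<M} (fst s)" "unitary_mat M (snd s)" by (auto simp: diagonalizes_def)
    then obtain b V where b: "antimono_on {..<M} b" and ab: "interlaces M (fst s) b"
      and V: "block_unitary M (fst s) V" and next_eq: "next_vector M (fst s) b (snd s) V = h (Suc (Suc k))"
      using exists_eigenstep h by blast
    let ?s = "(b, next_basis M (fst s) b (snd s) V)"
    have "\<forall>m<M. 0 \<le> b m" using nonneg ab by (auto simp: interlaces_def intro: order_trans)
    moreover have "diagonalizes M (?A (Suc (Suc k))) (fst ?s) (snd ?s)"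
      using diagonalizes_next_step(2)[OF d b ab V] frame_operator_Suc[of h "Suc k" M] h
      by (simp add: next_eq)
    ultimately have "P (Suc k) ?s" by (simp add: P_def)
    moreover have "Q k s ?s" using ab V next_eq by (auto simp: Q_def)
    ultimately show "\<exists>s'. P (Suc k) s' \<and> Q k s s'" by blast
  qed
  then obtain F where F: "\<And>k. P k (F k)" "\<And>k. Q k (F k) (F (Suc k))" by blast
  have "\<forall>k. \<exists>V. block_unitary M (fst (F k)) V \<and>
      h (Suc (Suc k)) = next_vector M (fst (F k)) (fst (F (Suc k))) (snd (F k)) V \<and>
      snd (F (Suc k)) = next_basis M (fst (F k)) (fst (F (Suc k))) (snd (F k)) V"
    using F(2) by (simp add: Q_def)
  from choice[OF this] obtain W where W: "\<And>k. block_unitary M (fst (F k)) (W k)"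
    "\<And>k. h (Suc (Suc k)) = next_vector M (fst (F k)) (fst (F (Suc k))) (snd (F k)) (W k)"
    "\<And>k. snd (F (Suc k)) = next_basis M (fst (F k)) (fst (F (Suc k))) (snd (F k)) (W k)" by blast
  define E where "E n = (if n = 0 then (\<lambda>_. 0) else fst (F (n - 1)))" for n
  define U where "U n = snd (F (n - 1))" for n
  define V where "V n = W (n - 1)" for n
  have E_Suc: "E (Suc k) = fst (F k)" and U_Suc: "U (Suc k) = snd (F k)" for k
    by (simp_all add: E_def U_def)
  have d: "diagonalizes M (?A (Suc k)) (E (Suc k)) (U (Suc k))" and nonneg: "m < M \<Longrightarrow> 0 \<le> E (Suc k) m" for k m
    using F(1)[of k] by (simp_all add: P_def E_Suc U_Suc)
  have start: "f 1 = of_real (sqrt (mu 1)) \<cdot>\<^sub>v col (U 1) 0" "interlaces M (E 0) (E 1)"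
    using F(1)[of 0] by (simp_all add: P_def E_def U_def)
  have U: "unitary_mat M (U (Suc k))" and E_anti: "antimono_on {..<M} (E (Suc k))" for k
    using d[of k] by (simp_all add: diagonalizes_def)
  have interl: "interlaces M (E k) (E (Suc k))" for k
  proof (cases k)
    case 0
    then show ?thesis using start(2) by simp
  next
    case (Suc j)
    then show ?thesis using F(2)[of j] by (simp add: Q_def E_Suc)
  qed
  have d': "\<exists>U. diagonalizes M (?A k) (E k) U" for k
  proof (cases k)
    case 0
    have "diagonalizes M (0\<^sub>m M M) (E 0) (U (Suc 0))" by (rule diagonalizes_zero[OF U]) (simp add: E_def)
    then show ?thesis using 0 by (auto simp: frame_operator_0)
  next
    case (Suc j)
    then show ?thesis using d[of j] by blast
  qed
  have sums: "(\<Sum>m<M. E n m) = (\<Sum>k=1..n. mu k)" if "n \<le> N" for n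
    using that
  proof (induction n)
    case 0
    then show ?case by (simp add: E_def)
  next
    case (Suc n)
    obtain U' where "diagonalizes M (?A n) (E n) U'" using d' by blast
    from diagonalizes_frame_operator_step[OF this d h]
    have "h (Suc n) \<bullet>c h (Suc n) = of_real ((\<Sum>m<M. E (Suc n) m) - (\<Sum>m<M. E n m))" .
    moreover have "h (Suc n) = f (Suc n)" using Suc.prems by (intro h_eq) simp
    moreover have "f (Suc n) \<bullet>c f (Suc n) = of_real (mu (Suc n))"
      using spec Suc.prems by (simp add: has_spectrum_and_lengths_def)
    ultimately have "(of_real ((\<Sum>m<M. E (Suc n) m) - (\<Sum>m<M. E n m)) :: 'a) = of_real (mu (Suc n))" by simp
    then have "(\<Sum>m<M. E (Suc n) m) - (\<Sum>m<M. E n m) = mu (Suc n)" by (simp only: of_real_eq_iff)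
    then show ?case using Suc by simp
  qed
  have final: "E N m = lam m" if "m < M" for m
  proof (rule has_spectrum_unique[OF _ _ that])
    obtain k where "N = Suc k" using N by (cases N) auto
    then show "has_spectrum M (?A N) (E N)" using d[of k] by (auto intro: diagonalizes_imp_has_spectrum)
    have "?A N = frame_operator M N f" by (rule frame_operator_cong) (rule h_eq)
    then show "has_spectrum M (?A N) lam" using spec by (simp add: has_spectrum_and_lengths_def)
  qed
  have "eigensteps M N lam mu E"
    unfolding eigensteps_def
  proof (intro conjI allI impI ballI)
    fix n m assume "n \<le> N" "m < M"
    then show "0 \<le> E n m" using nonneg[of m "n - 1"] by (cases n) (auto simp: E_def)
  next
    fix n assume "n \<le> N"
    show "antimono_on {..<M} (E n)" using E_anti[of "n - 1"] by (cases n) (auto simp: E_def monotone_on_def)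
  next
    fix n assume "n \<in> {1..N}"
    then show "interlaces M (E (n - 1)) (E n)" using interl[of "n - 1"] by simp
  next
    show "E 0 m = 0" for m by (simp add: E_def)
  qed (use final sums in auto)
  moreover have "block_unitary M (E n) (V n) \<and> f (Suc n) = next_vector M (E n) (E (Suc n)) (U n) (V n) \<and>
      U (Suc n) = next_basis M (E n) (E (Suc n)) (U n) (V n)" if n: "n \<in> {1..<N}" for n
  proof -
    obtain k where k: "n = Suc k" using n by (cases n) auto
    have "h (Suc n) = f (Suc n)" using n by (intro h_eq) simp
    then show ?thesis using W[of k] by (simp add: k E_Suc U_Suc V_def)
  qed
  ultimately have "algorithm_run M N lam mu E U V f"
    unfolding algorithm_run_def using start(1) U[of 0] by simp
  then show ?thesis by blast
qed

theorem theorem7: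
  fixes M N :: nat and lam mu :: "nat \<Rightarrow> real"
  assumes "M \<ge> 1" and "N \<ge> 1"
    and "\<forall>m<M. 0 \<le> lam m" and "antimono_on {..<M} lam"
    and "\<forall>n\<in>{1..N}. 0 \<le> mu n" and "antimono_on {1..N} mu"
  shows
    "(\<forall>E. eigensteps M N lam mu E \<longrightarrow>
        (\<forall>n\<in>{1..<N}. card (excess_indices M (E n) (E (Suc n))) =
                      card (excess_indices M (E (Suc n)) (E n)))) \<and>
     (\<forall>f :: nat \<Rightarrow> real vec.
        (\<forall>n\<in>{1..N}. f n \<in> carrier_vec M) \<longrightarrow> has_spectrum_and_lengths M N lam mu f \<longrightarrow>
        (\<exists>E U V. algorithm_run M N lam mu E U V f)) \<and>
     (\<forall>(f :: nat \<Rightarrow> real vec) E U V.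
        algorithm_run M N lam mu E U V f \<longrightarrow>
        (\<forall>n\<in>{1..N}. f n \<in> carrier_vec M) \<and> has_spectrum_and_lengths M N lam mu f \<and>
        (\<forall>n\<in>{1..N}. has_spectrum M (frame_operator M n f) (E n) \<and>
                     orthonormal_eigenbasis M (frame_operator M n f) (E n) (U n))) \<and>
     (\<forall>f :: nat \<Rightarrow> complex vec.
        (\<forall>n\<in>{1..N}. f n \<in> carrier_vec M) \<longrightarrow> has_spectrum_and_lengths M N lam mu f \<longrightarrow>
        (\<exists>E U V. algorithm_run M N lam mu E U V f)) \<and>
     (\<forall>(f :: nat \<Rightarrow> complex vec) E U V.
        algorithm_run M N lam mu E U V f \<longrightarrow>
        (\<forall>n\<in>{1..N}. f n \<in> carrier_vec M) \<and> has_spectrum_and_lengths M N lam mu f \<and>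
        (\<forall>n\<in>{1..N}. has_spectrum M (frame_operator M n f) (E n) \<and>
                     orthonormal_eigenbasis M (frame_operator M n f) (E n) (U n)))"
proof -
  have mu1: "0 \<le> mu 1" using assms(2,5) by simp
  note sound = algorithm_run_sound[where M = M and lam = lam and mu = mu, OF _ assms(1,2,4) mu1]
    and complete = algorithm_run_complete[where mu = mu, OF assms(1,2) mu1]
  show ?thesis
    by (intro conjI; intro allI impI;
        (rule complete | rule sound | intro ballI, rule eigensteps_card_excess_indices); assumption)
qed

end
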